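(* Let $\eta>0$. The wave operator $p(D)=\partial_{x_1}^2-\eta^2\partial_{x_2}^2$ on $\mathbb{T}^2$ satisfies the following properties: (i) If $\eta$ is irrational, then $\operatorname{ind}_{GH}(p(D))=\mu(\eta)$. (ii) If $\eta\in\mathbb{Q}$, then $\operatorname{ind}_{GH}(p(D))=\infty$. (iii) $\operatorname{ind}_{GS}(p(D))=\mu(\eta)$. Moreover, if $\eta\in\mathbb{Q}$, then $p(D)$ is GS-$1$. (iv) If $\eta$ is an algebraic number of degree $2$, then $p(D)$ is GH-$2$ and GS-$2$.
   Context: $\mathbb{T}^2=(\mathbb{R}/2\pi\mathbb{Z})^2$, and $\mathscr{D}'(\mathbb{T}^2)$ is its space of distributions. For $k\in\mathbb{R}$, $H^k(\mathbb{T}^2)$ is the set of $u\in\mathscr{D}'(\mathbb{T}^2)$ with $\sum_{\xi\in\mathbb{Z}^2}(1+\|\xi\|^2)^k|\widehat{u}(\xi)|^2<\infty$, where $\|\xi\|$ is the Euclidean norm and $\widehat{u}(\xi)$ are the Fourier coefficients. The operator $p(D)$ is a Fourier multiplier with symbol $p(\xi)=-\xi_1^2+\eta^2\xi_2^2$, of intrinsic order $m=2$. For $r\ge0$: - $p(D)$ is GH-$r$ (globally hypoelliptic with loss of $r$ derivatives) if for every $k\in\mathbb{R}$: $u\in\mathscr{D}'(\mathbb{T}^2)$ and $p(D)u\in H^k(\mathbb{T}^2)$ imply $u\in H^{k+2-r}(\mathbb{T}^2)$. - $p(D)$ is GS-$r$ (globally solvable with a loss of $r$ derivatives) if for every $k\in\mathbb{R}$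 and every $f\in H^k(\mathbb{T}^2)\cap(\ker{}^tp(D)\cap C^\infty(\mathbb{T}^2))^0$ there is $u\in H^{k+2-r}(\mathbb{T}^2)$ with $p(D)u=f$. Here ${}^tp(D)$ is the transpose (the Fourier multiplier with symbol $p(-\xi)$), and $E^0$ is the set of distributions $f$ with $\langle f,\phi\rangle=0$ for all $\phi\in E$ (bilinear duality bracket). - $\operatorname{ind}_{GH}(p(D))=\inf\{r\ge0: p(D)\text{ is GH-}r\}$ and $\operatorname{ind}_{GS}(p(D))=\inf\{r\ge0: p(D)\text{ is GS-}r\}$, with $\inf\emptyset=\infty$. The irrationality measure $\mu(\eta)\in(0,\infty]$ of a real number $\eta$ is the infimum of all real $\mu>0$ such that $0<|\eta-\frac{\xi_1}{\xi_2}|<\frac1{|\xi_2|^\mu}$ has at most finitely many solutions $\xi_1/\xi_2$, with $\xi_1,\xi_2\in\mathbb{Z}$, $\xi_2\ne0$ ($\mu(\eta)=\infty$ if there is no such $\mu$). The degree of an algebraic number is the smallest degree of a nonzero integer polynomial vanishing at it. *)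

theory Defs
  imports "HOL-Analysis.Analysis" "HOL-Computational_Algebra.Polynomial"
begin

section \<open>Smooth functions on the torus\<close>

text \<open>Functions on the torus \<open>(R / 2 pi Z)^2\<close> are represented by functions on the plane that are
  \<open>2 pi\<close>-periodic in each variable.\<close>

type_synonym fn = "real \<times> real \<Rightarrow> complex"

definition pderiv1 :: "fn \<Rightarrow> fn" where
  "pderiv1 f = (\<lambda>z. vector_derivative (\<lambda>t. f (t, snd z)) (at (fst z)))"

definition pderiv2 :: "fn \<Rightarrow> fn" where
  "pderiv2 f = (\<lambda>z. vector_derivative (\<lambda>t. f (fst z, t)) (at (snd z)))"

primrec C_k :: "nat \<Rightarrow> fn \<Rightarrow> bool" where
  "C_k 0 f = continuous_on UNIV f"
| "C_k (Suc n) f = ((\<forall>z. f differentiable (at z)) \<and> C_k n (pderiv1 f) \<and> C_k n (pderiv2 f))"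

definition periodic_T2 :: "fn \<Rightarrow> bool" where
  "periodic_T2 f \<longleftrightarrow> (\<forall>x y. f (x + 2 * pi, y) = f (x, y) \<and> f (x, y + 2 * pi) = f (x, y))"

definition smooth_T2 :: "fn set" where
  "smooth_T2 = {f. periodic_T2 f \<and> (\<forall>n. C_k n f)}"

definition Cm_norm :: "nat \<Rightarrow> fn \<Rightarrow> real" where
  "Cm_norm N f = (\<Sum>a\<le>N. \<Sum>b\<le>N - a. SUP z. cmod ((pderiv1 ^^ a) ((pderiv2 ^^ b) f) z))"

section \<open>Distributions\<close>

type_synonym dist = "fn \<Rightarrow> complex"

text \<open>A distribution is a linear functional on the smooth functions that is continuous for the
  family of \<open>C\<^sup>N\<close> norms. To make equality of distributions the equality of HOL, the functional is
  taken to be \<open>0\<close> outside \<open>smooth_T2\<close>. The (bilinear) bracket of \<open>u\<close> and \<open>\<phi>\<close> is \<open>u \<phi>\<close>.\<close>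

definition distributions :: "dist set" where
  "distributions = {u.
     (\<forall>\<phi>. \<phi> \<notin> smooth_T2 \<longrightarrow> u \<phi> = 0) \<and>
     (\<forall>\<phi>\<in>smooth_T2. \<forall>\<psi>\<in>smooth_T2. u (\<lambda>z. \<phi> z + \<psi> z) = u \<phi> + u \<psi>) \<and>
     (\<forall>c. \<forall>\<phi>\<in>smooth_T2. u (\<lambda>z. c * \<phi> z) = c * u \<phi>) \<and>
     (\<exists>C N. \<forall>\<phi>\<in>smooth_T2. cmod (u \<phi>) \<le> C * Cm_norm N \<phi>)}"

definition dist_of :: "fn \<Rightarrow> dist" where
  "dist_of f = (\<lambda>\<phi>. if \<phi> \<in> smooth_T2
     then integral (cbox (0, 0) (2 * pi, 2 * pi)) (\<lambda>z. f z * \<phi> z) else 0)"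

definition dist_pderiv1 :: "dist \<Rightarrow> dist" where
  "dist_pderiv1 u = (\<lambda>\<phi>. if \<phi> \<in> smooth_T2 then - u (pderiv1 \<phi>) else 0)"

definition dist_pderiv2 :: "dist \<Rightarrow> dist" where
  "dist_pderiv2 u = (\<lambda>\<phi>. if \<phi> \<in> smooth_T2 then - u (pderiv2 \<phi>) else 0)"

definition character :: "int \<times> int \<Rightarrow> fn" where
  "character \<xi> = (\<lambda>z. exp (\<i> * of_real (of_int (fst \<xi>) * fst z + of_int (snd \<xi>) * snd z)))"

definition fourier_coeff :: "dist \<Rightarrow> int \<times> int \<Rightarrow> complex" where
  "fourier_coeff u \<xi> = u (character (- \<xi>)) / of_real ((2 * pi)\<^sup>2)"

definition sobolev :: "real \<Rightarrow> dist set" where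
  "sobolev k = {u \<in> distributions.
     (\<lambda>\<xi>. (1 + ((of_int (fst \<xi>))\<^sup>2 + (of_int (snd \<xi>))\<^sup>2)) powr k * (cmod (fourier_coeff u \<xi>))\<^sup>2)
       summable_on UNIV}"

section \<open>Hypoellipticity and solvability with loss of derivatives\<close>

text \<open>The restriction to smooth functions of the transpose of an operator \<open>P\<close> on distributions:
  the distribution \<open>transpose_op P \<psi>\<close> is given by
  \<open>\<langle>transpose_op P \<psi>, \<phi>\<rangle> = \<langle>P \<phi>, \<psi>\<rangle>\<close> for smooth \<open>\<phi>\<close>. If \<open>P\<close> is the Fourier multiplier with
  symbol \<open>p(\<xi>)\<close>, taking \<open>\<phi>(x) = exp (- i x \<cdot> \<xi>)\<close> shows that \<open>transpose_op P\<close> is the Fourier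
  multiplier with symbol \<open>p(-\<xi>)\<close>.\<close>

definition transpose_op :: "(dist \<Rightarrow> dist) \<Rightarrow> fn \<Rightarrow> dist" where
  "transpose_op P \<psi> = (\<lambda>\<phi>. if \<phi> \<in> smooth_T2 then P (dist_of \<phi>) \<psi> else 0)"

definition smooth_ker_transpose :: "(dist \<Rightarrow> dist) \<Rightarrow> fn set" where
  "smooth_ker_transpose P = {\<psi> \<in> smooth_T2. transpose_op P \<psi> = (\<lambda>_. 0)}"

definition annihilator :: "fn set \<Rightarrow> dist set" where
  "annihilator E = {f \<in> distributions. \<forall>\<phi>\<in>E. f \<phi> = 0}"

text \<open>Here \<open>m\<close> is the order of the operator \<open>P\<close> and \<open>r\<close> the loss of derivatives.\<close>

definition GH :: "real \<Rightarrow> (dist \<Rightarrow> dist) \<Rightarrow> real \<Rightarrow> bool" where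
  "GH m P r \<longleftrightarrow> (\<forall>k. \<forall>u\<in>distributions. P u \<in> sobolev k \<longrightarrow> u \<in> sobolev (k + m - r))"

definition GS :: "real \<Rightarrow> (dist \<Rightarrow> dist) \<Rightarrow> real \<Rightarrow> bool" where
  "GS m P r \<longleftrightarrow> (\<forall>k. \<forall>f \<in> sobolev k \<inter> annihilator (smooth_ker_transpose P).
     \<exists>u\<in>sobolev (k + m - r). P u = f)"

definition ind_GH :: "real \<Rightarrow> (dist \<Rightarrow> dist) \<Rightarrow> ereal" where
  "ind_GH m P = Inf {ereal r |r. 0 \<le> r \<and> GH m P r}"

definition ind_GS :: "real \<Rightarrow> (dist \<Rightarrow> dist) \<Rightarrow> ereal" where
  "ind_GS m P = Inf {ereal r |r. 0 \<le> r \<and> GS m P r}"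

section \<open>The wave operator\<close>

definition wave_op :: "real \<Rightarrow> dist \<Rightarrow> dist" where
  "wave_op \<eta> u = (\<lambda>\<phi>. dist_pderiv1 (dist_pderiv1 u) \<phi>
     - of_real (\<eta>\<^sup>2) * dist_pderiv2 (dist_pderiv2 u) \<phi>)"

definition wave_symbol :: "real \<Rightarrow> int \<times> int \<Rightarrow> complex" where
  "wave_symbol \<eta> \<xi> = of_real (- (of_int (fst \<xi>))\<^sup>2 + \<eta>\<^sup>2 * (of_int (snd \<xi>))\<^sup>2)"

definition fourier_multiplier :: "(int \<times> int \<Rightarrow> complex) \<Rightarrow> (dist \<Rightarrow> dist) \<Rightarrow> bool" where
  "fourier_multiplier p P \<longleftrightarrow>
     (\<forall>u\<in>distributions. \<forall>\<xi>. fourier_coeff (P u) \<xi> = p \<xi> * fourier_coeff u \<xi>)"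

lemma scaled_character_deriv:
  "((\<lambda>t. c * exp (\<i> * of_real (a * t + b))) has_vector_derivative
     \<i> * of_real a * c * exp (\<i> * of_real (a * t + b))) (at t)" for a b t :: real and c :: complex
  by (rule derivative_eq_intros has_vector_derivative_real_field refl | simp)+

lemma pderiv1_character:
  "pderiv1 (\<lambda>z. c * character \<xi> z) = (\<lambda>z. (\<i> * of_int (fst \<xi>) * c) * character \<xi> z)"
proof
  fix z :: "real \<times> real"
  show "pderiv1 (\<lambda>z. c * character \<xi> z) z = (\<i> * of_int (fst \<xi>) * c) * character \<xi> z"
    using vector_derivative_at[OF scaled_character_deriv
        [of c "of_int (fst \<xi>)" "of_int (snd \<xi>) * snd z" "fst z"]]
    by (simp add: pderiv1_def character_def)
qed

lemma pderiv2_character: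
  "pderiv2 (\<lambda>z. c * character \<xi> z) = (\<lambda>z. (\<i> * of_int (snd \<xi>) * c) * character \<xi> z)"
proof
  fix z :: "real \<times> real"
  show "pderiv2 (\<lambda>z. c * character \<xi> z) z = (\<i> * of_int (snd \<xi>) * c) * character \<xi> z"
    using vector_derivative_at[OF scaled_character_deriv
        [of c "of_int (snd \<xi>)" "of_int (fst \<xi>) * fst z" "snd z"]]
    by (simp add: pderiv2_def character_def add.commute)
qed

lemma smooth_character: "(\<lambda>z. c * character \<xi> z) \<in> smooth_T2"
proof -
  have "periodic_T2 (\<lambda>z. c * character \<xi> z)"
  proof -
    have *: "exp (\<i> * of_real (of_int n * (x + 2 * pi))) = exp (\<i> * of_real (of_int n * x))"
      for n :: int and x :: real
      using exp_integer_2pi[of "of_int n"]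
      by (simp add: algebra_simps exp_add)
    show ?thesis
      using * by (simp add: periodic_T2_def character_def distrib_left[of \<i>] exp_add)
  qed
  moreover have "C_k n (\<lambda>z. c * character \<xi> z)" for n
  proof (induction n arbitrary: c)
    case 0
    show ?case by (auto simp: character_def intro!: continuous_intros)
  next
    case (Suc n)
    have "(\<lambda>z. c * character \<xi> z) differentiable (at z)" for z
    proof -
      have "(\<lambda>z. \<i> * of_real (of_int (fst \<xi>) * fst z + of_int (snd \<xi>) * snd z))
          differentiable (at (z :: real \<times> real))"
        by (rule linear_imp_differentiable)
           (auto intro!: linearI simp: algebra_simps scaleR_conv_of_real)
      moreover have "exp differentiable (at w)" for w :: complex
        using DERIV_exp[of w] by (auto simp: differentiable_def has_field_derivative_def)
      ultimately have "character \<xi> differentiable (at z)"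
        unfolding character_def using differentiable_chain_at[unfolded o_def] by blast
      then show ?thesis by (intro differentiable_mult) auto
    qed
    with Suc show ?case by (simp add: pderiv1_character pderiv2_character)
  qed
  ultimately show ?thesis by (simp add: smooth_T2_def)
qed

lemma fourier_multiplier_wave_op: "fourier_multiplier (wave_symbol \<eta>) (wave_op \<eta>)"
proof -
  have "wave_op \<eta> u (character \<xi>) = wave_symbol \<eta> \<xi> * u (character \<xi>)"
    if u: "u \<in> distributions" for u \<xi>
  proof -
    have s: "character \<xi> \<in> smooth_T2" using smooth_character[of 1 \<xi>] by simp
    have d: "pderiv1 (character \<xi>) = (\<lambda>z. (\<i> * of_int (fst \<xi>)) * character \<xi> z)"
      "pderiv2 (character \<xi>) = (\<lambda>z. (\<i> * of_int (snd \<xi>)) * character \<xi> z)"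
      using pderiv1_character[of 1 \<xi>] pderiv2_character[of 1 \<xi>] by simp_all
    have l: "u (\<lambda>z. c * character \<xi> z) = c * u (character \<xi>)" for c
      using u s by (auto simp: distributions_def)
    show ?thesis
      unfolding wave_op_def dist_pderiv1_def dist_pderiv2_def wave_symbol_def
      by (simp only: s d smooth_character pderiv1_character pderiv2_character l if_True)
         (simp add: power2_eq_square algebra_simps)
  qed
  then show ?thesis
    by (simp add: fourier_multiplier_def fourier_coeff_def wave_symbol_def)
qed

section \<open>Diophantine notions\<close>

definition irrationality_measure :: "real \<Rightarrow> ereal" where
  "irrationality_measure \<eta> = Inf {ereal \<mu> |\<mu>. 0 < \<mu> \<and>
     finite {x. \<exists>p q :: int. q \<noteq> 0 \<and> x = of_int p / of_int q \<and>
                  0 < \<bar>\<eta> - x\<bar> \<and> \<bar>\<eta> - x\<bar> < 1 / \<bar>of_int q\<bar> powr \<mu>}}"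

text \<open>Only meaningful if \<open>x\<close> is \<open>algebraic\<close>; otherwise the value is unspecified.\<close>

definition algebraic_degree :: "real \<Rightarrow> nat" where
  "algebraic_degree x = (LEAST d. \<exists>p. (\<forall>i. coeff p i \<in> \<int>) \<and> p \<noteq> 0 \<and> poly p x = 0 \<and> degree p = d)"

end

theory Submission
  imports Defs
begin

text \<open>A distribution on the torus is determined by its Fourier coefficients, and every polynomially
  bounded family of coefficients comes from a distribution. Hence everything is governed by the size
  of the symbol \<open>p(\<xi>) = (\<eta> \<xi>\<^sub>2 - \<xi>\<^sub>1) (\<eta> \<xi>\<^sub>2 + \<xi>\<^sub>1)\<close> off its zeros: a loss of \<open>r\<close> derivatives
  in solving the equation is possible exactly if \<open>|p(\<xi>)| \<ge> c (1 + |\<xi>|\<^sup>2)\<^bsup>1 - r/2\<^esup>\<close> whenever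
  \<open>p(\<xi>) \<noteq> 0\<close>, for otherwise the indicator of a sparse set of frequencies with small symbol is a
  counterexample. Hypoellipticity requires in addition that \<open>p\<close> has only finitely many zeros. Near the
  lines \<open>\<xi>\<^sub>1 = \<plusminus> \<eta> \<xi>\<^sub>2\<close> one has \<open>|p(\<xi>)| \<approx> |\<xi>|\<^sup>2 |\<eta> - |\<xi>\<^sub>1/\<xi>\<^sub>2||\<close>, so up to an
  arbitrarily small change of \<open>r\<close> the bound says that \<open>\<eta>\<close> is not approximable to order \<open>r\<close>.\<close>

section \<open>Derivatives of smooth functions on the torus\<close>

text \<open>The exponent \<open>1 - r / 2\<close> comes from comparing weights: dividing by p, off
  its zeros, maps \<open>H^k\<close> into \<open>H^(k+2-r)\<close> as soon as p squared dominates
  the power \<open>2 - r\<close> of the squared bracket. \<open>k\<close> drops out of this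
  condition, so one \<open>k\<close> is enough for a counterexample, and \<open>k = r - 2\<close>
  makes the target space \<open>H^0\<close>. The analytic work lies in the passage to coefficients,
  because solvability asks for an equality of functionals. A distribution is only known to be
  continuous for some \<open>C^N\<close> norm, so the Fourier series of a test function must
  converge to it in each of these norms. This rests on the decay of the coefficients, by integration
  by parts, and on uniqueness for continuous periodic functions, by approximation with trigonometric
  polynomials. The small change of \<open>r\<close> absorbs a constant: the irrationality measure
  compares with constant 1, the symbol bound with an unspecified one. It occurs in one direction
  only; finitely many approximants of order \<open>r\<close> give the bound with the same
  \<open>r\<close>.\<close>

lemma character_add: "character (\<xi> + \<zeta>) z = character \<xi> z * character \<zeta> z"
  by (simp add: character_def algebra_simps flip: exp_add)

lemma character_zero [simp]: "character 0 z = 1"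
  by (simp add: character_def)

lemma norm_character [simp]: "cmod (character \<xi> z) = 1"
  by (simp add: character_def)

lemma continuous_character: "continuous_on S (character \<xi>)"
  by (auto simp: character_def intro!: continuous_intros)

lemma smooth_char: "character \<xi> \<in> smooth_T2"
  using smooth_character[of 1 \<xi>] by simp

lemma smooth_T2_D:
  assumes f: "f \<in> smooth_T2"
  shows "periodic_T2 f" "C_k n f" "continuous_on S f" "f differentiable (at z)"
proof -
  have *: "C_k n f" for n using f by (simp add: smooth_T2_def)
  show "C_k n f" by (rule *)
  show "continuous_on S f" using *[of 0] by (auto intro: continuous_on_subset)
  show "f differentiable (at z)" using *[of "Suc 0"] by (simp only: C_k.simps)
  show "periodic_T2 f" using f by (simp add: smooth_T2_def)
qed

text \<open>\<open>C_k\<close> speaks of total differentiability, \<open>pderiv1\<close> of a slice.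
  Composing with the affine slice map shows that \<open>vector_derivative\<close> is a genuine
  derivative here and not a default value.\<close>

lemma has_pderiv1:
  assumes "f differentiable (at (x, y))"
  shows "((\<lambda>t. f (t, y)) has_vector_derivative pderiv1 f (x, y)) (at x)"
proof -
  have "(\<lambda>t. (t, y)) differentiable (at x)" for x :: real
    by (auto simp: differentiable_def intro!: derivative_eq_intros exI)
  then have "(\<lambda>t. f (t, y)) differentiable (at x)"
    using differentiable_chain_at[of "\<lambda>t. (t, y)" x f] assms by (simp add: o_def)
  then show ?thesis by (simp add: pderiv1_def vector_derivative_works)
qed

lemma has_pderiv2:
  assumes "f differentiable (at (x, y))"
  shows "((\<lambda>t. f (x, t)) has_vector_derivative pderiv2 f (x, y)) (at y)"
proof -
  have "(\<lambda>t. (x, t)) differentiable (at y)" for y :: real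
    by (auto simp: differentiable_def intro!: derivative_eq_intros exI)
  then have "(\<lambda>t. f (x, t)) differentiable (at y)"
    using differentiable_chain_at[of "\<lambda>t. (x, t)" y f] assms by (simp add: o_def)
  then show ?thesis by (simp add: pderiv2_def vector_derivative_works)
qed

lemma pderiv1_eqI: "((\<lambda>t. f (t, y)) has_vector_derivative d) (at x) \<Longrightarrow> pderiv1 f (x, y) = d"
  by (simp add: pderiv1_def vector_derivative_at)

lemma pderiv2_eqI: "((\<lambda>t. f (x, t)) has_vector_derivative d) (at y) \<Longrightarrow> pderiv2 f (x, y) = d"
  by (simp add: pderiv2_def vector_derivative_at)

lemma has_vector_derivative_shift:
  fixes f :: "real \<Rightarrow> complex"
  assumes "(f has_vector_derivative d) (at (x + p))" "\<And>t. f (t + p) = f t"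
  shows "(f has_vector_derivative d) (at x)"
proof -
  have "((\<lambda>t. t + p) has_vector_derivative 1) (at x)"
    by (auto intro!: derivative_eq_intros)
  from vector_diff_chain_at[OF this assms(1)] show ?thesis
    using assms(2) by (simp add: o_def)
qed

lemma smooth_pderiv1: "pderiv1 f \<in> smooth_T2" if f: "f \<in> smooth_T2"
proof -
  note p = smooth_T2_D(1)[OF f, unfolded periodic_T2_def, rule_format]
  have "pderiv1 f (x + 2 * pi, y) = pderiv1 f (x, y)" for x y
    by (rule pderiv1_eqI[symmetric], rule has_vector_derivative_shift[where p = "2 * pi"])
      (use has_pderiv1[OF smooth_T2_D(4)[OF f]] p in auto)
  moreover have "pderiv1 f (x, y + 2 * pi) = pderiv1 f (x, y)" for x y
    using p by (simp add: pderiv1_def)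
  moreover have "C_k n (pderiv1 f)" for n
    using smooth_T2_D(2)[OF f, of "Suc n"] by simp
  ultimately show ?thesis by (simp add: smooth_T2_def periodic_T2_def)
qed

lemma smooth_pderiv2: "pderiv2 f \<in> smooth_T2" if f: "f \<in> smooth_T2"
proof -
  note p = smooth_T2_D(1)[OF f, unfolded periodic_T2_def, rule_format]
  have "pderiv2 f (x, y + 2 * pi) = pderiv2 f (x, y)" for x y
    by (rule pderiv2_eqI[symmetric], rule has_vector_derivative_shift[where p = "2 * pi"])
      (use has_pderiv2[OF smooth_T2_D(4)[OF f]] p in auto)
  moreover have "pderiv2 f (x + 2 * pi, y) = pderiv2 f (x, y)" for x y
    using p by (simp add: pderiv2_def)
  moreover have "C_k n (pderiv2 f)" for n
    using smooth_T2_D(2)[OF f, of "Suc n"] by simp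
  ultimately show ?thesis by (simp add: smooth_T2_def periodic_T2_def)
qed

text \<open>The shape \<open>f + c * g\<close> serves sums, differences (\<open>c = -1\<close>) and
  scalar multiples (\<open>f = 0\<close>) at once.\<close>

lemma pderiv_lincomb:
  assumes f: "\<And>z. f differentiable (at z)" and g: "\<And>z. g differentiable (at z)"
  shows pderiv1_lincomb: "pderiv1 (\<lambda>z. f z + c * g z) = (\<lambda>z. pderiv1 f z + c * pderiv1 g z)"
    and pderiv2_lincomb: "pderiv2 (\<lambda>z. f z + c * g z) = (\<lambda>z. pderiv2 f z + c * pderiv2 g z)"
proof -
  have "pderiv1 (\<lambda>z. f z + c * g z) (x, y) = pderiv1 f (x, y) + c * pderiv1 g (x, y)" for x y
    by (rule pderiv1_eqI)
      (rule has_vector_derivative_add[OF has_pderiv1[OF f]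
          has_vector_derivative_mult_right[OF has_pderiv1[OF g]]])
  then show "pderiv1 (\<lambda>z. f z + c * g z) = (\<lambda>z. pderiv1 f z + c * pderiv1 g z)" by auto
  have "pderiv2 (\<lambda>z. f z + c * g z) (x, y) = pderiv2 f (x, y) + c * pderiv2 g (x, y)" for x y
    by (rule pderiv2_eqI)
      (rule has_vector_derivative_add[OF has_pderiv2[OF f]
          has_vector_derivative_mult_right[OF has_pderiv2[OF g]]])
  then show "pderiv2 (\<lambda>z. f z + c * g z) = (\<lambda>z. pderiv2 f z + c * pderiv2 g z)" by auto
qed

lemma C_k_lincomb: "C_k n f \<Longrightarrow> C_k n g \<Longrightarrow> C_k n (\<lambda>z. f z + c * g z)"
proof (induction n arbitrary: f g)
  case 0
  then show ?case by (auto intro!: continuous_intros)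
next
  case (Suc n)
  have f: "\<And>z. f differentiable (at z)" and g: "\<And>z. g differentiable (at z)"
    using Suc.prems by (simp_all only: C_k.simps)
  show ?case
    unfolding C_k.simps(2) pderiv_lincomb[OF f g]
    using Suc by (auto intro!: derivative_intros f g)
qed

lemma smooth_lincomb: "f \<in> smooth_T2 \<Longrightarrow> g \<in> smooth_T2 \<Longrightarrow> (\<lambda>z. f z + c * g z) \<in> smooth_T2"
  by (auto simp: smooth_T2_def periodic_T2_def C_k_lincomb simp del: C_k.simps)

lemma smooth_sum:
  assumes "finite A"
  shows "(\<lambda>z. \<Sum>\<xi>\<in>A. c \<xi> * character \<xi> z) \<in> smooth_T2"
  using assms
proof (induction A)
  case empty
  show ?case using smooth_character[of 0 0] by simp
next
  case (insert \<xi> A)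
  then show ?case
    using smooth_lincomb[OF insert.IH smooth_char[of \<xi>], of "c \<xi>"] by (simp add: add.commute)
qed

abbreviation pd :: "nat \<Rightarrow> nat \<Rightarrow> fn \<Rightarrow> fn" where
  "pd a b f \<equiv> (pderiv1 ^^ a) ((pderiv2 ^^ b) f)"

lemma smooth_pd: "f \<in> smooth_T2 \<Longrightarrow> pd a b f \<in> smooth_T2"
proof (induction a)
  case 0
  then show ?case by (induction b) (auto simp: smooth_pderiv2)
qed (auto simp: smooth_pderiv1)

lemma pd_lincomb:
  assumes f: "f \<in> smooth_T2" and g: "g \<in> smooth_T2"
  shows "pd a b (\<lambda>z. f z + c * g z) = (\<lambda>z. pd a b f z + c * pd a b g z)"
proof (induction a)
  case 0
  show ?case
  proof (induction b)
    case (Suc b)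
    then show ?case
      using smooth_T2_D(4)[OF smooth_pd[OF f, of 0 b]] smooth_T2_D(4)[OF smooth_pd[OF g, of 0 b]]
      by (simp add: pderiv_lincomb)
  qed simp
next
  case (Suc a)
  then show ?case
    using smooth_T2_D(4)[OF smooth_pd[OF f, of a b]] smooth_T2_D(4)[OF smooth_pd[OF g, of a b]]
    by (simp add: pderiv_lincomb)
qed

lemma pd_character:
  "pd a b (\<lambda>z. c * character \<xi> z) =
     (\<lambda>z. (\<i> * of_int (fst \<xi>)) ^ a * (\<i> * of_int (snd \<xi>)) ^ b * c * character \<xi> z)"
proof (induction a)
  case 0
  show ?case
  proof (induction b)
    case (Suc b)
    then show ?case using pderiv2_character[of "(\<i> * of_int (snd \<xi>)) ^ b * c" \<xi>] by (simp add: mult.assoc)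
  qed simp
next
  case (Suc a)
  then show ?case
    using pderiv1_character[of "(\<i> * of_int (fst \<xi>)) ^ a * (\<i> * of_int (snd \<xi>)) ^ b * c" \<xi>]
    by (simp add: mult.assoc)
qed

lemma pd_sum:
  assumes "finite A"
  shows "pd a b (\<lambda>z. \<Sum>\<xi>\<in>A. c \<xi> * character \<xi> z) =
    (\<lambda>z. \<Sum>\<xi>\<in>A. (\<i> * of_int (fst \<xi>)) ^ a * (\<i> * of_int (snd \<xi>)) ^ b * c \<xi> * character \<xi> z)"
  using assms
proof (induction A)
  case empty
  show ?case using pd_character[of a b 0 0] by simp
next
  case (insert \<xi> A)
  have "(\<lambda>z. \<Sum>\<xi>\<in>insert \<xi> A. c \<xi> * character \<xi> z) =
      (\<lambda>z. (\<Sum>\<xi>\<in>A. c \<xi> * character \<xi> z) + 1 * (c \<xi> * character \<xi> z))"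
    using insert.hyps by (simp add: add.commute)
  then show ?case
    using insert pd_lincomb[OF smooth_sum[OF insert.hyps(1)] smooth_character, of a b c 1 "c \<xi>" \<xi>]
    by (simp add: pd_character add.commute)
qed

section \<open>Periodicity and the norms of test functions\<close>

lemma periodic_int:
  assumes "periodic_T2 f"
  shows "f (x + 2 * pi * of_int m, y + 2 * pi * of_int n) = f (x, y)"
proof -
  note p = assms[unfolded periodic_T2_def, rule_format]
  have 1: "f (x + 2 * pi * real k, y) = f (x, y)" for x y k
  proof (induction k)
    case (Suc k)
    then show ?case
      using p[of "x + 2 * pi * real k" y] p[of x "y + 2 * pi * real k"] by (simp add: algebra_simps)
  qed simp
  have 2: "f (x, y + 2 * pi * real k) = f (x, y)" for x y k
  proof (induction k)
    case (Suc k)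
    then show ?case
      using p[of "x + 2 * pi * real k" y] p[of x "y + 2 * pi * real k"] by (simp add: algebra_simps)
  qed simp
  have 3: "f (x + 2 * pi * of_int m, y) = f (x, y)" for x y
  proof (cases "m \<ge> 0")
    case True
    then show ?thesis using 1[of x "nat m" y] by simp
  next
    case False
    then show ?thesis using 1[of "x + 2 * pi * of_int m" "nat (-m)" y] by simp
  qed
  have 4: "f (x, y + 2 * pi * of_int n) = f (x, y)" for x y
  proof (cases "n \<ge> 0")
    case True
    then show ?thesis using 2[of x y "nat n"] by simp
  next
    case False
    then show ?thesis using 2[of x "y + 2 * pi * of_int n" "nat (-n)"] by simp
  qed
  show ?thesis using 3 4 by simp
qed

lemma shift_into_period: "\<exists>n::int. 0 \<le> x - 2 * pi * of_int n \<and> x - 2 * pi * of_int n < 2 * pi" for x :: real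
proof
  let ?n = "\<lfloor>x / (2 * pi)\<rfloor>"
  have "of_int ?n * (2 * pi) \<le> x" "x < (of_int ?n + 1) * (2 * pi)"
    by (auto intro: floor_divide_lower floor_divide_upper)
  then show "0 \<le> x - 2 * pi * of_int ?n \<and> x - 2 * pi * of_int ?n < 2 * pi"
    by (simp add: algebra_simps)
qed

abbreviation cell :: "(real \<times> real) set" where
  "cell \<equiv> cbox (0, 0) (2 * pi, 2 * pi)"

lemma periodic_cell:
  assumes "periodic_T2 f"
  obtains w where "w \<in> cell" "f w = f z"
proof -
  obtain x y where z: "z = (x, y)" by (cases z)
  obtain m n :: int where mn: "0 \<le> x - 2 * pi * of_int m \<and> x - 2 * pi * of_int m < 2 * pi"
    "0 \<le> y - 2 * pi * of_int n \<and> y - 2 * pi * of_int n < 2 * pi"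
    using shift_into_period by meson
  let ?w = "(x - 2 * pi * of_int m, y - 2 * pi * of_int n)"
  show thesis
  proof (rule that)
    show "?w \<in> cell" using mn by simp
    show "f ?w = f z"
      using periodic_int[OF assms, of "x - 2 * pi * of_int m" m "y - 2 * pi * of_int n" n] z by simp
  qed
qed

lemma periodic_bounded:
  assumes "periodic_T2 f" "continuous_on UNIV f"
  shows "bounded (range f)"
proof -
  have "compact (f ` cell)"
    using assms(2) by (intro compact_continuous_image) (auto intro: continuous_on_subset)
  moreover have "range f \<subseteq> f ` cell"
    using periodic_cell[OF assms(1)] by (metis image_subsetI imageI)
  ultimately show ?thesis by (metis bounded_subset compact_imp_bounded)
qed

text \<open>A real \<open>SUP\<close> bounds its members only if the set is bounded, so this is what
  makes \<open>Cm_norm\<close> an upper bound for derivatives.\<close>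

lemma smooth_bdd_above: "f \<in> smooth_T2 \<Longrightarrow> bdd_above (range (\<lambda>z. cmod (f z)))"
  using bounded_imp_bdd_above[of "range (\<lambda>z. cmod (f z))"] periodic_bounded[OF smooth_T2_D(1) smooth_T2_D(3)]
  by (simp add: bounded_norm_comp)

lemma pd_le_Cm_norm:
  assumes "f \<in> smooth_T2" "a + b \<le> N"
  shows "cmod (pd a b f z) \<le> Cm_norm N f"
proof -
  let ?s = "\<lambda>a b. SUP z. cmod (pd a b f z)"
  have le: "cmod (pd a b f z) \<le> ?s a b" for a b z
    by (rule cSUP_upper[OF _ smooth_bdd_above[OF smooth_pd[OF assms(1)]]]) simp
  then have nn: "0 \<le> ?s a b" for a b
    by (rule order_trans[OF norm_ge_zero])
  have "?s a b \<le> (\<Sum>b\<le>N - a. ?s a b)"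
    using assms(2) nn by (intro member_le_sum) auto
  also have "\<dots> \<le> Cm_norm N f"
    unfolding Cm_norm_def
    using assms(2) nn by (intro member_le_sum[of a _ "\<lambda>a. \<Sum>b\<le>N - a. ?s a b"] sum_nonneg) auto
  finally show ?thesis using le[of a b z] by linarith
qed

text \<open>The factor is a crude count of the pairs \<open>(a, b)\<close>; only convergence to 0
  will matter.\<close>

lemma Cm_norm_leI:
  assumes "\<And>a b z. a + b \<le> N \<Longrightarrow> cmod (pd a b f z) \<le> K" "K \<ge> 0"
  shows "Cm_norm N f \<le> (real N + 1)\<^sup>2 * K"
proof -
  have "Cm_norm N f \<le> (\<Sum>a\<le>N. \<Sum>b\<le>N - a. K)"
    unfolding Cm_norm_def by (intro sum_mono cSUP_least) (auto intro!: assms)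
  also have "\<dots> = (\<Sum>a\<le>N. (real (N - a) + 1) * K)" by (simp add: add.commute)
  also have "\<dots> \<le> (\<Sum>a\<le>N. (real N + 1) * K)"
    using assms(2) by (intro sum_mono mult_right_mono) auto
  also have "\<dots> = (real N + 1)\<^sup>2 * K" by (simp add: power2_eq_square add.commute)
  finally show ?thesis .
qed

lemma Cm_norm_nonneg: "f \<in> smooth_T2 \<Longrightarrow> 0 \<le> Cm_norm N f"
  by (rule order_trans[OF norm_ge_zero pd_le_Cm_norm[of f 0 0]]) auto

section \<open>Fourier integrals of smooth functions\<close>

text \<open>In the first variable the fundamental theorem leaves two boundary values that cancel by
  periodicity; Fubini does the rest.\<close>

lemma integral_pderiv1_eq_0:
  assumes per: "periodic_T2 f" and diff: "\<And>z. f differentiable (at z)"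
    and cont: "continuous_on UNIV (pderiv1 f)"
  shows "integral cell (pderiv1 f) = 0"
proof -
  have c: "continuous_on (cbox (0, 0) (2 * pi, 2 * pi)) (\<lambda>(x, y). pderiv1 f (x, y))"
    using cont by (auto intro: continuous_on_subset)
  have "((\<lambda>x. pderiv1 f (x, y)) has_integral f (2 * pi, y) - f (0, y)) {0..2 * pi}" for y
    by (rule fundamental_theorem_of_calculus)
      (auto intro!: has_vector_derivative_at_within has_pderiv1 diff)
  moreover have "f (2 * pi, y) = f (0, y)" for y
    using per[unfolded periodic_T2_def, rule_format, of 0 y] by simp
  ultimately have "integral (cbox 0 (2 * pi)) (\<lambda>x. pderiv1 f (x, y)) = 0" for y
    by (metis cancel_comm_monoid_add_class.diff_cancel cbox_interval integral_unique)
  \<comment> \<open>Iterated integration has the second variable innermost, so the order is swapped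
    to integrate the derivative first.\<close>
  then show ?thesis
    using integral_prod_continuous[OF c] integral_swap_continuous[OF c] by simp
qed

lemma integral_pderiv2_eq_0:
  assumes per: "periodic_T2 f" and diff: "\<And>z. f differentiable (at z)"
    and cont: "continuous_on UNIV (pderiv2 f)"
  shows "integral cell (pderiv2 f) = 0"
proof -
  have c: "continuous_on (cbox (0, 0) (2 * pi, 2 * pi)) (pderiv2 f)"
    using cont by (auto intro: continuous_on_subset)
  have "((\<lambda>y. pderiv2 f (x, y)) has_integral f (x, 2 * pi) - f (x, 0)) {0..2 * pi}" for x
    by (rule fundamental_theorem_of_calculus)
      (auto intro!: has_vector_derivative_at_within has_pderiv2 diff)
  moreover have "f (x, 2 * pi) = f (x, 0)" for x
    using per[unfolded periodic_T2_def, rule_format, of x 0] by simp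
  ultimately have "integral (cbox 0 (2 * pi)) (\<lambda>y. pderiv2 f (x, y)) = 0" for x
    by (metis cancel_comm_monoid_add_class.diff_cancel cbox_interval integral_unique)
  then show ?thesis
    using integral_prod_continuous[OF c] by simp
qed

lemma periodic_character: "periodic_T2 (character \<xi>)"
  by (rule smooth_T2_D(1)[OF smooth_char])

text \<open>This is \<open>(2 pi)\<^sup>2\<close> times the Fourier coefficient of \<open>f\<close> at \<open>- \<xi>\<close>: the sign is the one of the
  bilinear pairing with \<open>character \<xi>\<close>.\<close>

definition fint :: "fn \<Rightarrow> int \<times> int \<Rightarrow> complex" where
  "fint f \<xi> = integral cell (\<lambda>z. f z * character \<xi> z)"

lemma integrable_cell: "continuous_on UNIV f \<Longrightarrow> f integrable_on cell" for f :: "real \<times> real \<Rightarrow> complex"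
  by (rule integrable_continuous) (auto intro: continuous_on_subset)

text \<open>Integration by parts: the derivative of \<open>f\<close> times the character integrates
  to 0, and the character is an eigenfunction of both derivatives.\<close>

lemma fint_pderiv:
  assumes f: "f \<in> smooth_T2"
  shows fint_pderiv1: "fint (pderiv1 f) \<xi> = - \<i> * of_int (fst \<xi>) * fint f \<xi>"
    and fint_pderiv2: "fint (pderiv2 f) \<xi> = - \<i> * of_int (snd \<xi>) * fint f \<xi>"
proof -
  have s: "character \<xi> \<in> smooth_T2" by (rule smooth_char)
  note df = smooth_T2_D(4)[OF f] and dc = smooth_T2_D(4)[OF s]
  let ?g = "\<lambda>z. f z * character \<xi> z"
  have per: "periodic_T2 ?g"
    using smooth_T2_D(1)[OF f] smooth_T2_D(1)[OF s] by (simp add: periodic_T2_def)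
  have diff: "?g differentiable (at z)" for z
    by (rule differentiable_mult[OF df dc])
  note cont = smooth_T2_D(3)[OF f, of UNIV] smooth_T2_D(3)[OF s, of UNIV]
    smooth_T2_D(3)[OF smooth_pderiv1[OF f], of UNIV] smooth_T2_D(3)[OF smooth_pderiv2[OF f], of UNIV]
  have "pderiv1 ?g (x, y) = pderiv1 f (x, y) * character \<xi> (x, y)
      + \<i> * of_int (fst \<xi>) * (f (x, y) * character \<xi> (x, y))" for x y
    using has_vector_derivative_mult[OF has_pderiv1[OF df[of "(x, y)"]] has_pderiv1[OF dc[of "(x, y)"]]]
      pderiv1_character[of 1 \<xi>]
    by (intro pderiv1_eqI) (simp add: algebra_simps)
  then have g1: "pderiv1 ?g = (\<lambda>z. pderiv1 f z * character \<xi> z + \<i> * of_int (fst \<xi>) * ?g z)"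
    by auto
  have "integral cell (pderiv1 ?g) = 0"
    by (rule integral_pderiv1_eq_0[OF per diff]) (use cont in \<open>auto simp: g1 intro!: continuous_intros\<close>)
  also have "integral cell (pderiv1 ?g) = fint (pderiv1 f) \<xi> + \<i> * of_int (fst \<xi>) * fint f \<xi>"
    unfolding g1 fint_def integral_mult_right[symmetric]
    by (intro integral_add integrable_cell continuous_intros cont)
  finally show "fint (pderiv1 f) \<xi> = - \<i> * of_int (fst \<xi>) * fint f \<xi>"
    by (simp add: eq_neg_iff_add_eq_0)
  have "pderiv2 ?g (x, y) = pderiv2 f (x, y) * character \<xi> (x, y)
      + \<i> * of_int (snd \<xi>) * (f (x, y) * character \<xi> (x, y))" for x y
    using has_vector_derivative_mult[OF has_pderiv2[OF df[of "(x, y)"]] has_pderiv2[OF dc[of "(x, y)"]]]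
      pderiv2_character[of 1 \<xi>]
    by (intro pderiv2_eqI) (simp add: algebra_simps)
  then have g2: "pderiv2 ?g = (\<lambda>z. pderiv2 f z * character \<xi> z + \<i> * of_int (snd \<xi>) * ?g z)"
    by auto
  have "integral cell (pderiv2 ?g) = 0"
    by (rule integral_pderiv2_eq_0[OF per diff]) (use cont in \<open>auto simp: g2 intro!: continuous_intros\<close>)
  also have "integral cell (pderiv2 ?g) = fint (pderiv2 f) \<xi> + \<i> * of_int (snd \<xi>) * fint f \<xi>"
    unfolding g2 fint_def integral_mult_right[symmetric]
    by (intro integral_add integrable_cell continuous_intros cont)
  finally show "fint (pderiv2 f) \<xi> = - \<i> * of_int (snd \<xi>) * fint f \<xi>"
    by (simp add: eq_neg_iff_add_eq_0)
qed

lemma fint_pd: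
  assumes f: "f \<in> smooth_T2"
  shows "fint (pd a b f) \<xi> = (- \<i> * of_int (fst \<xi>)) ^ a * (- \<i> * of_int (snd \<xi>)) ^ b * fint f \<xi>"
proof (induction a)
  case 0
  show ?case
  proof (induction b)
    case (Suc b)
    then show ?case using fint_pderiv2[OF smooth_pd[OF f, of 0 b], of \<xi>] by simp
  qed simp
next
  case (Suc a)
  then show ?case using fint_pderiv1[OF smooth_pd[OF f, of a b], of \<xi>] by simp
qed

lemma content_cell: "measure lborel cell = (2 * pi)\<^sup>2"
  by (subst content_Pair) (simp add: power2_eq_square)

lemma norm_fint_le:
  assumes "continuous_on UNIV f" "\<And>z. cmod (f z) \<le> B"
  shows "cmod (fint f \<xi>) \<le> B * (2 * pi)\<^sup>2"
proof -
  have "B \<ge> 0" using order_trans[OF norm_ge_zero assms(2)] .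
  moreover have "((\<lambda>z. f z * character \<xi> z) has_integral fint f \<xi>) cell"
    unfolding fint_def
    by (intro integrable_integral integrable_cell continuous_intros continuous_character assms)
  ultimately have "cmod (fint f \<xi>) \<le> B * measure lborel cell"
    by (rule has_integral_bound) (simp add: norm_mult assms)
  then show ?thesis by (simp only: content_cell)
qed

lemma fint_lincomb:
  assumes "continuous_on UNIV f" "continuous_on UNIV g"
  shows "fint (\<lambda>z. f z + c * g z) \<xi> = fint f \<xi> + c * fint g \<xi>"
proof -
  have "fint (\<lambda>z. f z + c * g z) \<xi> =
      integral cell (\<lambda>z. f z * character \<xi> z + c * (g z * character \<xi> z))"
    by (simp add: fint_def algebra_simps)
  also have "\<dots> = fint f \<xi> + c * fint g \<xi>"
    unfolding fint_def integral_mult_right[symmetric]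
    by (intro integral_add integrable_cell continuous_intros assms continuous_character)
  finally show ?thesis .
qed

text \<open>A nontrivial character is a nonzero multiple of one of its own partial derivatives, and
  those integrate to 0.\<close>

lemma fint_character: "fint (character \<zeta>) \<xi> = (if \<xi> = - \<zeta> then (2 * pi)\<^sup>2 else 0)"
proof -
  let ?c = "character (\<zeta> + \<xi>)"
  have s: "?c \<in> smooth_T2" by (rule smooth_char)
  have fint: "fint (character \<zeta>) \<xi> = integral cell ?c"
    by (simp add: fint_def character_add[abs_def])
  show ?thesis
  proof (cases "\<xi> = - \<zeta>")
    case True
    then have "integral cell ?c = integral cell (\<lambda>z. 1)" by (simp add: character_def)
    also have "\<dots> = (2 * pi)\<^sup>2" by (simp add: content_cell scaleR_conv_of_real)
    finally show ?thesis using True fint by simp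
  next
    case False
    then have "\<zeta> + \<xi> \<noteq> 0" by (metis add_eq_0_iff)
    then consider "fst (\<zeta> + \<xi>) \<noteq> 0" | "snd (\<zeta> + \<xi>) \<noteq> 0" by (metis prod_eqI fst_zero snd_zero)
    then have "integral cell ?c = 0"
    proof cases
      case 1
      have "integral cell (pderiv1 ?c) = 0"
        by (rule integral_pderiv1_eq_0[OF smooth_T2_D(1,4)[OF s] smooth_T2_D(3)[OF smooth_pderiv1[OF s]]])
      moreover have "pderiv1 ?c = (\<lambda>z. \<i> * of_int (fst (\<zeta> + \<xi>)) * ?c z)"
        using pderiv1_character[of 1 "\<zeta> + \<xi>"] by (simp del: fst_add)
      ultimately show ?thesis using 1 by (simp del: fst_add)
    next
      case 2
      have "integral cell (pderiv2 ?c) = 0"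
        by (rule integral_pderiv2_eq_0[OF smooth_T2_D(1,4)[OF s] smooth_T2_D(3)[OF smooth_pderiv2[OF s]]])
      moreover have "pderiv2 ?c = (\<lambda>z. \<i> * of_int (snd (\<zeta> + \<xi>)) * ?c z)"
        using pderiv2_character[of 1 "\<zeta> + \<xi>"] by (simp del: snd_add)
      ultimately show ?thesis using 2 by (simp del: snd_add)
    qed
    then show ?thesis using False fint by simp
  qed
qed

section \<open>The Japanese bracket, decay and summability\<close>

text \<open>The square of the Japanese bracket of \<open>\<xi>\<close>.\<close>

definition jb :: "int \<times> int \<Rightarrow> real" where
  "jb \<xi> = 1 + ((of_int (fst \<xi>))\<^sup>2 + (of_int (snd \<xi>))\<^sup>2)"

lemma jb_ge_1: "1 \<le> jb \<xi>" and jb_pos: "0 < jb \<xi>"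
  by (simp_all add: jb_def add_pos_nonneg)

lemma jb_uminus [simp]: "jb (- \<xi>) = jb \<xi>"
  by (simp add: jb_def)

text \<open>The three terms on the right are the multipliers of \<open>pd 0 0\<close>,
  \<open>pd (2 * m) 0\<close> and \<open>pd 0 (2 * m)\<close>, so derivatives of order at most
  \<open>2 * m\<close> control the decay.\<close>

lemma jb_power_le: "jb \<xi> ^ m \<le> 3 ^ m * (1 + \<bar>of_int (fst \<xi>)\<bar> ^ (2 * m) + \<bar>of_int (snd \<xi>)\<bar> ^ (2 * m))"
proof -
  let ?x = "(of_int (fst \<xi>))\<^sup>2 :: real" and ?y = "(of_int (snd \<xi>))\<^sup>2 :: real"
  let ?M = "max 1 (max ?x ?y)"
  have "jb \<xi> ^ m \<le> (3 * ?M) ^ m"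
    unfolding jb_def by (intro power_mono) auto
  also have "\<dots> = 3 ^ m * ?M ^ m" by (simp add: power_mult_distrib)
  also have "?M ^ m \<le> 1 + ?x ^ m + ?y ^ m"
    by (auto simp: max_def)
  finally show ?thesis by (simp add: power_mult)
qed

lemma fint_decay:
  assumes f: "f \<in> smooth_T2"
  shows "jb \<xi> ^ m * cmod (fint f \<xi>) \<le> 3 ^ Suc m * (2 * pi)\<^sup>2 * Cm_norm (2 * m) f"
proof -
  have *: "\<bar>of_int (fst \<xi>)\<bar> ^ a * \<bar>of_int (snd \<xi>)\<bar> ^ b * cmod (fint f \<xi>) \<le> Cm_norm (2 * m) f * (2 * pi)\<^sup>2"
    if "a + b \<le> 2 * m" for a b
  proof -
    have "cmod (fint (pd a b f) \<xi>) \<le> Cm_norm (2 * m) f * (2 * pi)\<^sup>2"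
      by (rule norm_fint_le[OF smooth_T2_D(3)[OF smooth_pd[OF f]] pd_le_Cm_norm[OF f that]])
    then show ?thesis by (simp add: fint_pd[OF f] norm_mult norm_power)
  qed
  have "jb \<xi> ^ m * cmod (fint f \<xi>) \<le>
      3 ^ m * (1 + \<bar>of_int (fst \<xi>)\<bar> ^ (2 * m) + \<bar>of_int (snd \<xi>)\<bar> ^ (2 * m)) * cmod (fint f \<xi>)"
    by (intro mult_right_mono jb_power_le) auto
  also have "\<dots> \<le> 3 ^ m * (3 * (Cm_norm (2 * m) f * (2 * pi)\<^sup>2))"
    using *[of 0 0] *[of "2 * m" 0] *[of 0 "2 * m"]
    unfolding mult.assoc by (intro mult_left_mono) (auto simp: distrib_right)
  finally show ?thesis by (simp add: mult_ac)
qed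

lemma summable_on_inverse_squares: "(\<lambda>n::int. 1 / (1 + (of_int n)\<^sup>2) :: real) summable_on UNIV"
proof -
  have "summable (\<lambda>n. 1 / (1 + (real n)\<^sup>2))"
    by (rule summable_comparison_test'[OF inverse_power_summable[of 2, where 'a = real], of 1])
      (auto simp: inverse_eq_divide intro!: divide_left_mono mult_pos_pos add_pos_nonneg)
  then have s: "(\<lambda>n. 1 / (1 + (real n)\<^sup>2)) summable_on UNIV"
    by (rule summable_nonneg_imp_summable_on) auto
  have "(\<lambda>n::int. 1 / (1 + (of_int n)\<^sup>2) :: real) summable_on range int"
    using s by (subst summable_on_reindex) (auto simp: o_def)
  moreover have "(\<lambda>n::int. 1 / (1 + (of_int n)\<^sup>2) :: real) summable_on range (\<lambda>n. - int n)"
    using s by (subst summable_on_reindex) (auto simp: o_def inj_on_def)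
  ultimately have "(\<lambda>n::int. 1 / (1 + (of_int n)\<^sup>2) :: real) summable_on range int \<union> range (\<lambda>n. - int n)"
    by (rule summable_on_union)
  moreover have "range int \<union> range (\<lambda>n. - int n) = UNIV"
    by (auto, metis int_cases2 range_eqI)
  ultimately show ?thesis by simp
qed

text \<open>Both one-dimensional factors \<open>1 + m^2\<close> and \<open>1 + n^2\<close> are at
  most \<open>jb\<close>, so a product of two summable functions dominates. Hence two extra powers
  of \<open>jb\<close> suffice later.\<close>

lemma summable_on_jb: "(\<lambda>\<xi>. 1 / jb \<xi> ^ 2) summable_on UNIV"
proof -
  define r :: "int \<Rightarrow> real" where "r n = 1 / (1 + (of_int n)\<^sup>2)" for n
  let ?g = "\<lambda>(m, n). r m * r n"
  have r: "r summable_on UNIV" "r n \<ge> 0" for n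
    using summable_on_inverse_squares by (simp_all add: r_def[abs_def])
  have s: "infsum r UNIV \<ge> 0" by (rule infsum_nonneg) (rule r)
  have "(\<lambda>\<xi>. norm (?g \<xi>)) summable_on UNIV \<times> UNIV"
    using r s
    by (subst Infinite_Sum.abs_summable_on_Sigma_iff)
      (auto simp: infsum_cmult_right' abs_mult intro!: summable_on_cmult_right summable_on_cmult_left)
  then have "(\<lambda>\<xi>. norm (1 / jb \<xi> ^ 2)) summable_on UNIV"
    unfolding UNIV_Times_UNIV
  proof (rule Infinite_Sum.abs_summable_on_comparison_test)
    fix \<xi> :: "int \<times> int"
    obtain m n where \<xi>: "\<xi> = (m, n)" by (cases \<xi>)
    have "(1 + (of_int m)\<^sup>2) * (1 + (of_int n)\<^sup>2) \<le> jb \<xi> * jb \<xi>"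
      by (intro mult_mono) (auto simp: jb_def \<xi>)
    then show "norm (1 / jb \<xi> ^ 2) \<le> norm (?g \<xi>)"
      using jb_pos[of \<xi>] by (simp add: \<xi> r_def power2_eq_square frac_le add_pos_nonneg abs_mult)
  qed
  then show ?thesis by simp
qed

section \<open>Uniqueness and inversion of Fourier series\<close>

text \<open>Generating the class by rules makes closure under products and the vanishing of
  integrals plain inductions.\<close>

inductive trigpoly :: "fn \<Rightarrow> bool" where
  trigpoly_character: "trigpoly (\<lambda>z. c * character \<xi> z)"
| trigpoly_add: "trigpoly p \<Longrightarrow> trigpoly q \<Longrightarrow> trigpoly (\<lambda>z. p z + q z)"

lemma trigpoly_const: "trigpoly (\<lambda>z. c)"
  using trigpoly_character[of c 0] by simp

lemma trigpoly_mult: "trigpoly p \<Longrightarrow> trigpoly q \<Longrightarrow> trigpoly (\<lambda>z. p z * q z)"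
proof (induction p rule: trigpoly.induct)
  case p: (trigpoly_character c \<xi>)
  from p show ?case
  proof (induction q rule: trigpoly.induct)
    case (trigpoly_character d \<zeta>)
    show ?case
      using trigpoly.trigpoly_character[of "c * d" "\<xi> + \<zeta>"] by (simp add: character_add[abs_def] mult_ac)
  next
    case (trigpoly_add q r)
    then show ?case by (simp add: distrib_left trigpoly.trigpoly_add)
  qed
next
  case (trigpoly_add p r)
  then show ?case by (simp add: distrib_right trigpoly.trigpoly_add)
qed

lemma continuous_trigpoly: "trigpoly p \<Longrightarrow> continuous_on S p"
  by (induction rule: trigpoly.induct) (auto intro!: continuous_intros continuous_character)

text \<open>These are the pullbacks of the four real coordinates of the torus, which separate its
  points.\<close>

lemma trigpoly_cos_sin:
  "trigpoly (\<lambda>z. of_real (cos (fst z)))" "trigpoly (\<lambda>z. of_real (sin (fst z)))"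
  "trigpoly (\<lambda>z. of_real (cos (snd z)))" "trigpoly (\<lambda>z. of_real (sin (snd z)))"
proof -
  have e: "trigpoly (\<lambda>z. a * exp (\<i> * of_real (fst z)) + b * exp (- (\<i> * of_real (fst z))))"
    "trigpoly (\<lambda>z. a * exp (\<i> * of_real (snd z)) + b * exp (- (\<i> * of_real (snd z))))" for a b
    using trigpoly_add[OF trigpoly_character[of a "(1, 0)"] trigpoly_character[of b "(-1, 0)"]]
      trigpoly_add[OF trigpoly_character[of a "(0, 1)"] trigpoly_character[of b "(0, -1)"]]
    by (simp_all add: character_def)
  have c: "complex_of_real (cos t) = 1 / 2 * exp (\<i> * of_real t) + 1 / 2 * exp (- (\<i> * of_real t))"
    and s: "complex_of_real (sin t) = - \<i> / 2 * exp (\<i> * of_real t) + \<i> / 2 * exp (- (\<i> * of_real t))"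
    for t
    by (simp_all add: complex_eq_iff Re_exp Im_exp)
  show "trigpoly (\<lambda>z. of_real (cos (fst z)))" "trigpoly (\<lambda>z. of_real (sin (fst z)))"
    "trigpoly (\<lambda>z. of_real (cos (snd z)))" "trigpoly (\<lambda>z. of_real (sin (snd z)))"
    unfolding c s by (rule e)+
qed

section \<open>Density of trigonometric polynomials and uniqueness\<close>

abbreviation torus :: "(complex \<times> complex) set" where
  "torus \<equiv> sphere 0 1 \<times> sphere 0 1"

definition torus_map :: "real \<times> real \<Rightarrow> complex \<times> complex" where
  "torus_map z = (cis (fst z), cis (snd z))"

lemma continuous_torus_map: "continuous_on S torus_map"
  unfolding torus_map_def by (intro continuous_intros)

lemma torus_map_image: "torus_map ` cell = torus"
proof
  show "torus_map ` cell \<subseteq> torus" by (auto simp: torus_map_def)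
  have *: "\<exists>t\<in>{0..2 * pi}. w = cis t" if "cmod w = 1" for w
  proof -
    have "(Re w)\<^sup>2 + (Im w)\<^sup>2 = 1" using that by (simp add: cmod_def)
    then obtain t where "0 \<le> t" "t < 2 * pi" "Re w = cos t" "Im w = sin t"
      by (rule sincos_total_2pi)
    then show ?thesis by (intro bexI[of _ t]) (auto simp: complex_eq_iff)
  qed
  show "torus \<subseteq> torus_map ` cell"
  proof clarsimp
    fix a b :: complex assume "cmod a = 1" "cmod b = 1"
    then obtain s t where "s \<in> {0..2 * pi}" "t \<in> {0..2 * pi}" "a = cis s" "b = cis t"
      using * by blast
    then show "(a, b) \<in> torus_map ` cell"
      by (intro image_eqI[of _ _ "(s, t)"]) (auto simp: torus_map_def)
  qed
qed

lemma torus_map_eq_imp: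
  assumes "periodic_T2 f" "torus_map z = torus_map w"
  shows "f z = f w"
proof -
  obtain x y x' y' where zw: "z = (x, y)" "w = (x', y')" by (cases z, cases w)
  have "sin x = sin x' \<and> cos x = cos x'" "sin y = sin y' \<and> cos y = cos y'"
    using assms(2) by (auto simp: zw torus_map_def complex_eq_iff)
  then obtain m n :: int where "x = x' + 2 * pi * m" "y = y' + 2 * pi * n"
    unfolding sin_cos_eq_iff by blast
  then show ?thesis using periodic_int[OF assms(1)] by (simp add: zw)
qed

text \<open>A periodic function descends to a continuous function on the product of two unit circles, where
  the Stone--Weierstrass theorem applies.\<close>

lemma trigpoly_approx:
  fixes f :: "real \<times> real \<Rightarrow> real"
  assumes per: "periodic_T2 (\<lambda>z. of_real (f z))" and cont: "continuous_on UNIV f" and "e > 0"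
  obtains p where "trigpoly p" "\<And>z. z \<in> cell \<Longrightarrow> cmod (of_real (f z) - p z) < e"
proof -
  define G where "G w = f (SOME z. z \<in> cell \<and> torus_map z = w)" for w
  have G: "G (torus_map z) = f z" if "z \<in> cell" for z
  proof -
    let ?z = "SOME z'. z' \<in> cell \<and> torus_map z' = torus_map z"
    have "?z \<in> cell \<and> torus_map ?z = torus_map z"
      by (rule someI[of _ z]) (use that in auto)
    then have "complex_of_real (f ?z) = of_real (f z)"
      by (intro torus_map_eq_imp[OF per]) auto
    then show ?thesis by (simp add: G_def)
  qed
  \<comment> \<open>The choice inside \<open>G\<close> need not be continuous. But
    \<open>torus_map\<close> maps the compact \<open>cell\<close> onto the torus and is a quotient
    map, so openness can be tested on preimages in \<open>cell\<close>, where \<open>G\<close>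
    becomes \<open>f\<close>.\<close>
  have "continuous_on torus G"
    unfolding continuous_openin_preimage_eq
  proof (intro allI impI)
    fix V :: "real set" assume V: "open V"
    have "cell \<inter> torus_map -` (torus \<inter> G -` V) = cell \<inter> f -` V"
    proof (intro set_eqI)
      fix z
      have "torus_map z \<in> torus" if "z \<in> cell" using that torus_map_image by blast
      then show "z \<in> cell \<inter> torus_map -` (torus \<inter> G -` V) \<longleftrightarrow> z \<in> cell \<inter> f -` V"
        using G[of z] by (simp only: Int_iff vimage_eq) metis
    qed
    moreover have "openin (top_of_set cell) (cell \<inter> f -` V)"
      using cont V by (meson continuous_on_subset continuous_openin_preimage_gen subset_UNIV)
    ultimately show "openin (top_of_set torus) (torus \<inter> G -` V)"
      using Abstract_Topology_2.continuous_imp_quotient_map[OF continuous_torus_map torus_map_image compact_cbox, of "torus \<inter> G -` V"]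
      by auto
  qed
  \<comment> \<open>Stone--Weierstrass is applied to the algebra of real functions whose pullback is
    a trigonometric polynomial.\<close>
  define P where "P F \<longleftrightarrow> continuous_on torus F \<and> trigpoly (\<lambda>z. of_real (F (torus_map z)))"
    for F :: "complex \<times> complex \<Rightarrow> real"
  have coord: "P (\<lambda>w. Re (fst w))" "P (\<lambda>w. Im (fst w))" "P (\<lambda>w. Re (snd w))" "P (\<lambda>w. Im (snd w))"
    by (auto simp: P_def torus_map_def trigpoly_cos_sin intro!: continuous_intros)
  have "\<exists>F. P F \<and> (\<forall>w\<in>torus. \<bar>G w - F w\<bar> < e)"
  proof (rule Stone_Weierstrass_HOL[of torus P G e])
    show "compact torus" by (intro compact_Times) auto
    show "\<exists>F. P F \<and> F x \<noteq> F y" if "x \<in> torus \<and> y \<in> torus \<and> x \<noteq> y" for x y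
    proof -
      have "Re (fst x) \<noteq> Re (fst y) \<or> Im (fst x) \<noteq> Im (fst y) \<or> Re (snd x) \<noteq> Re (snd y) \<or> Im (snd x) \<noteq> Im (snd y)"
        using that by (auto simp: prod_eq_iff complex_eq_iff)
      then show ?thesis using coord by blast
    qed
    show "P (\<lambda>x. F x + H x)" "P (\<lambda>x. F x * H x)" if "P F \<and> P H" for F H
      using that trigpoly_add[of "\<lambda>z. of_real (F (torus_map z))" "\<lambda>z. of_real (H (torus_map z))"]
        trigpoly_mult[of "\<lambda>z. of_real (F (torus_map z))" "\<lambda>z. of_real (H (torus_map z))"]
      by (simp_all add: P_def continuous_on_add continuous_on_mult)
    show "P (\<lambda>x. c)" for c by (simp add: P_def trigpoly_const)
    show "continuous_on torus F" if "P F" for F using that by (simp add: P_def)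
  qed fact+
  then obtain F where F: "P F" "\<And>w. w \<in> torus \<Longrightarrow> \<bar>G w - F w\<bar> < e"
    by auto
  show thesis
  proof (rule that)
    show "trigpoly (\<lambda>z. of_real (F (torus_map z)))" using F by (simp add: P_def)
    fix z assume "z \<in> cell"
    then show "cmod (of_real (f z) - of_real (F (torus_map z))) < e"
      using F(2)[of "torus_map z"] G[of z] imageI[of z cell torus_map]
      by (simp only: torus_map_image) (metis norm_of_real of_real_diff)
  qed
qed

lemma integral_trigpoly_eq_0:
  assumes "continuous_on UNIV h" "\<And>\<xi>. fint h \<xi> = 0" "trigpoly p"
  shows "integral cell (\<lambda>z. h z * p z) = 0"
  using assms(3)
proof (induction rule: trigpoly.induct)
  case (trigpoly_character c \<xi>)
  have "integral cell (\<lambda>z. h z * (c * character \<xi> z)) = integral cell (\<lambda>z. c * (h z * character \<xi> z))"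
    by (simp add: mult_ac)
  also have "\<dots> = c * fint h \<xi>" by (simp only: fint_def integral_mult_right)
  finally show ?case using assms(2) by simp
next
  case (trigpoly_add p q)
  have "integral cell (\<lambda>z. h z * (p z + q z)) = integral cell (\<lambda>z. h z * p z + h z * q z)"
    by (simp add: distrib_left)
  also have "\<dots> = integral cell (\<lambda>z. h z * p z) + integral cell (\<lambda>z. h z * q z)"
    using trigpoly_add.hyps[THEN continuous_trigpoly] assms(1)
    by (intro integral_add integrable_cell continuous_on_mult) auto
  finally show ?case using trigpoly_add.IH by simp
qed

text \<open>\<open>h\<close> is orthogonal to every trigonometric polynomial, and these approximate
  its conjugate uniformly. So the integral of the squared modulus of \<open>h\<close> vanishes, and
  continuity gives \<open>h = 0\<close>.\<close>

lemma fourier_uniqueness: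
  assumes per: "periodic_T2 h" and cont: "continuous_on UNIV h" and zero: "\<And>\<xi>. fint h \<xi> = 0"
  shows "h z = 0"
proof -
  obtain B where B: "\<And>z. cmod (h z) \<le> B"
    using periodic_bounded[OF per cont] by (auto simp: bounded_iff)
  have "B \<ge> 0" by (rule order_trans[OF norm_ge_zero B])
  have intg: "(\<lambda>z. h z * cnj (h z)) integrable_on cell"
    by (intro integrable_cell continuous_intros cont)
  define J where "J = integral cell (\<lambda>z. h z * cnj (h z))"
  have "cmod J \<le> B * (2 * pi)\<^sup>2 * (2 * e)" if "e > 0" for e
  proof -
    have pR: "periodic_T2 (\<lambda>z. complex_of_real (Re (h z)))" and pI: "periodic_T2 (\<lambda>z. complex_of_real (Im (h z)))"
      using per by (auto simp: periodic_T2_def)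
    obtain p where p: "trigpoly p" "\<And>z. z \<in> cell \<Longrightarrow> cmod (of_real (Re (h z)) - p z) < e"
      using trigpoly_approx[OF pR continuous_on_Re[OF cont] \<open>e > 0\<close>] by blast
    obtain q where q: "trigpoly q" "\<And>z. z \<in> cell \<Longrightarrow> cmod (of_real (Im (h z)) - q z) < e"
      using trigpoly_approx[OF pI continuous_on_Im[OF cont] \<open>e > 0\<close>] by blast
    \<comment> \<open>Real and imaginary parts are approximated separately; the sign makes
      \<open>r\<close> close to \<open>cnj (h z)\<close>.\<close>
    define r where "r z = p z + - \<i> * q z" for z
    have r: "trigpoly r"
      unfolding r_def[abs_def] by (intro trigpoly_add p trigpoly_mult trigpoly_const q)
    have close: "cmod (cnj (h z) - r z) \<le> 2 * e" if "z \<in> cell" for z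
    proof -
      have "cnj (h z) - r z = (of_real (Re (h z)) - p z) + - \<i> * (of_real (Im (h z)) - q z)"
        by (simp add: complex_eq_iff r_def)
      then have "cmod (cnj (h z) - r z) \<le> cmod (of_real (Re (h z)) - p z) + cmod (of_real (Im (h z)) - q z)"
        using norm_triangle_ineq[of "of_real (Re (h z)) - p z" "- \<i> * (of_real (Im (h z)) - q z)"]
        by (simp only: norm_mult norm_minus_cancel norm_ii mult_1)
      then show ?thesis using p(2)[OF that] q(2)[OF that] by linarith
    qed
    have "J = integral cell (\<lambda>z. h z * cnj (h z)) - integral cell (\<lambda>z. h z * r z)"
      using integral_trigpoly_eq_0[OF cont zero r] by (simp add: J_def)
    also have "\<dots> = integral cell (\<lambda>z. h z * cnj (h z) - h z * r z)"
      by (intro integral_diff[symmetric] intg integrable_cell continuous_intros cont continuous_trigpoly r)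
    also have "\<dots> = integral cell (\<lambda>z. h z * (cnj (h z) - r z))" by (simp add: right_diff_distrib)
    finally have J: "J = integral cell (\<lambda>z. h z * (cnj (h z) - r z))" .
    have "((\<lambda>z. h z * (cnj (h z) - r z)) has_integral J) cell"
      unfolding J by (intro integrable_integral integrable_cell continuous_intros cont continuous_trigpoly r)
    then have "cmod J \<le> (B * (2 * e)) * measure lborel cell"
      using \<open>B \<ge> 0\<close> \<open>e > 0\<close> B close
      by (intro has_integral_bound[of _ "\<lambda>z. h z * (cnj (h z) - r z)"]) (auto simp: norm_mult intro!: mult_mono)
    then show ?thesis unfolding content_cell by (simp add: mult_ac)
  qed
  then have *: "cmod J \<le> B * (2 * pi)\<^sup>2 * (2 * e)" if "e > 0" for e using that by blast
  have "cmod J \<le> 0 + d" if "d > 0" for d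
  proof -
    \<comment> \<open>The \<open>+ 1\<close> keeps the denominator positive when
      \<open>B = 0\<close>.\<close>
    let ?e = "d / (2 * (B * (2 * pi)\<^sup>2 + 1))"
    have pos: "0 < B * (2 * pi)\<^sup>2 + 1" using \<open>B \<ge> 0\<close> by (simp add: add_nonneg_pos)
    have "cmod J \<le> B * (2 * pi)\<^sup>2 * (2 * ?e)" by (rule *) (use pos that in auto)
    also have "\<dots> \<le> (B * (2 * pi)\<^sup>2 + 1) * (2 * ?e)" using pos that by (intro mult_right_mono) auto
    also have "\<dots> = d" using pos by (simp add: field_simps)
    finally show ?thesis by simp
  qed
  then have "J = 0" using field_le_epsilon[of "cmod J" 0] by simp
  have "((\<lambda>z. Re (h z * cnj (h z))) has_integral Re J) cell"
    unfolding J_def by (rule has_integral_Re[OF integrable_integral[OF intg]])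
  then have "integral cell (\<lambda>z. Re (h z * cnj (h z))) = 0" using \<open>J = 0\<close> by (simp add: integral_unique)
  moreover have "box (0, 0) (2 * pi, 2 * pi) \<noteq> ({} :: (real \<times> real) set)"
    using box_ne_empty(2)[of "(0, 0) :: real \<times> real" "(2 * pi, 2 * pi)"] by (auto simp: Basis_prod_def)
  moreover have "continuous_on cell (\<lambda>z. Re (h z * cnj (h z)))"
    by (intro continuous_intros continuous_on_subset[OF cont]) auto
  ultimately have "\<forall>z\<in>cell. Re (h z * cnj (h z)) = 0"
    by (subst integral_cbox_eq_0_iff[symmetric]) auto
  then have "\<forall>z\<in>cell. h z = 0" by (simp add: complex_eq_iff)
  moreover obtain w where "w \<in> cell" "h w = h z" by (rule periodic_cell[OF per])
  ultimately show ?thesis by force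
qed

definition polybdd :: "(int \<times> int \<Rightarrow> complex) \<Rightarrow> bool" where
  "polybdd c \<longleftrightarrow> (\<exists>K n. \<forall>\<xi>. cmod (c \<xi>) \<le> K * jb \<xi> ^ n)"

text \<open>Of the decay of order \<open>n + 2\<close>, \<open>n\<close> powers absorb the growth of
  \<open>c\<close> and two are left for summability. The dependence on \<open>Cm_norm\<close> is
  explicit because it later yields the continuity of \<open>synth c\<close>.\<close>

lemma polybdd_fint_bound:
  assumes c: "\<And>\<xi>. cmod (c \<xi>) \<le> K * jb \<xi> ^ n" and "f \<in> smooth_T2"
  shows "cmod (c \<xi> * fint f \<xi>) \<le> (K * (3 ^ (n + 3) * (2 * pi)\<^sup>2) * Cm_norm (2 * (n + 2)) f) * (1 / jb \<xi> ^ 2)"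
proof -
  have j: "0 < jb \<xi>" by (rule jb_pos)
  have "0 \<le> K * jb \<xi> ^ n" using order_trans[OF norm_ge_zero c] .
  then have "0 \<le> K" using zero_less_power[OF j, of n] by (auto simp: zero_le_mult_iff)
  have "cmod (c \<xi> * fint f \<xi>) \<le> K * jb \<xi> ^ n * cmod (fint f \<xi>)"
    by (simp add: norm_mult mult_right_mono c)
  also have "\<dots> = K * (jb \<xi> ^ (n + 2) * cmod (fint f \<xi>)) * (1 / jb \<xi> ^ 2)"
    using j by (simp add: power_add power2_eq_square field_simps)
  also have "\<dots> \<le> K * (3 ^ Suc (n + 2) * (2 * pi)\<^sup>2 * Cm_norm (2 * (n + 2)) f) * (1 / jb \<xi> ^ 2)"
    by (rule mult_right_mono[OF mult_left_mono[OF fint_decay[OF assms(2)] \<open>0 \<le> K\<close>]]) simp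
  finally show ?thesis by (simp add: mult_ac numeral_3_eq_3)
qed

lemma summable_on_norm_leI:
  fixes f :: "'a \<Rightarrow> complex"
  assumes "g summable_on A" "\<And>x. x \<in> A \<Longrightarrow> cmod (f x) \<le> g x"
  shows "(\<lambda>x. norm (f x)) summable_on A"
proof (rule Infinite_Sum.abs_summable_on_comparison_test)
  have "0 \<le> g x" if "x \<in> A" for x using order_trans[OF norm_ge_zero assms(2)[OF that]] .
  then show "(\<lambda>x. norm (g x)) summable_on A"
    using assms(1) by (subst summable_on_cong[of _ _ g]) auto
  show "norm (f x) \<le> norm (g x)" if "x \<in> A" for x using assms(2)[OF that] by auto
qed

lemma polybdd_summable:
  assumes "polybdd c" "f \<in> smooth_T2"
  shows "(\<lambda>\<xi>. norm (c \<xi> * fint f \<xi>)) summable_on UNIV" "(\<lambda>\<xi>. c \<xi> * fint f \<xi>) summable_on UNIV"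
proof -
  obtain K n where "\<And>\<xi>. cmod (c \<xi>) \<le> K * jb \<xi> ^ n" using assms(1) by (auto simp: polybdd_def)
  from polybdd_fint_bound[OF this assms(2)]
  show "(\<lambda>\<xi>. norm (c \<xi> * fint f \<xi>)) summable_on UNIV"
    by (rule summable_on_norm_leI[OF summable_on_cmult_right[OF summable_on_jb]])
  then show "(\<lambda>\<xi>. c \<xi> * fint f \<xi>) summable_on UNIV" by (rule abs_summable_summable)
qed

text \<open>The summands are the true Fourier coefficients of \<open>f\<close>, hence the sign; the
  weight pays for differentiating the series.\<close>

lemma fint_uminus_summable:
  assumes f: "f \<in> smooth_T2"
  shows "(\<lambda>\<xi>. jb \<xi> ^ n * cmod (fint f (- \<xi>) / (2 * pi)\<^sup>2)) summable_on UNIV"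
proof -
  have "polybdd (\<lambda>\<xi>. of_real (jb \<xi> ^ n / (2 * pi)\<^sup>2))"
    unfolding polybdd_def using jb_pos[THEN less_imp_le]
    by (intro exI[of _ "1 / (2 * pi)\<^sup>2"] exI[of _ n]) (auto simp: norm_divide norm_power)
  from polybdd_summable(1)[OF this f]
  have "(\<lambda>\<xi>. jb \<xi> ^ n * cmod (fint f \<xi> / (2 * pi)\<^sup>2)) summable_on UNIV"
    using jb_pos[THEN less_imp_le] by (simp add: norm_mult norm_divide norm_power)
  then show ?thesis
    using summable_on_reindex_bij_betw[OF bij_uminus, of "\<lambda>\<xi>. jb \<xi> ^ n * cmod (fint f \<xi> / (2 * pi)\<^sup>2)"]
    by simp
qed

text \<open>The series converges uniformly to a continuous periodic \<open>g\<close>. Termwise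
  integration shows that \<open>g\<close> and \<open>f\<close> have the same coefficients, so
  uniqueness identifies them.\<close>

lemma fourier_inversion:
  assumes f: "f \<in> smooth_T2"
  shows "((\<lambda>\<xi>. fint f (- \<xi>) / (2 * pi)\<^sup>2 * character \<xi> z) has_sum f z) UNIV"
proof -
  define a where "a \<xi> = fint f (- \<xi>) / (2 * pi)\<^sup>2" for \<xi>
  have a: "(\<lambda>\<xi>. cmod (a \<xi>)) summable_on UNIV"
    using fint_uminus_summable[OF f, of 0] by (simp add: a_def)
  define g where "g z = (\<Sum>\<^sub>\<infinity>\<xi>. a \<xi> * character \<xi> z)" for z
  have summ: "(\<lambda>\<xi>. a \<xi> * character \<xi> z) summable_on UNIV" for z
    by (rule abs_summable_summable) (use a in \<open>simp add: norm_mult\<close>)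
  have "uniform_limit UNIV (\<lambda>F z. \<Sum>\<xi>\<in>F. a \<xi> * character \<xi> z) g (finite_subsets_at_top UNIV)"
    unfolding g_def by (rule Weierstrass_m_test_general[OF _ a]) (simp add: norm_mult)
  then have contg: "continuous_on UNIV g"
    by (rule uniform_limit_theorem[rotated])
      (auto intro!: always_eventually continuous_intros continuous_character)
  have perg: "periodic_T2 g"
    using periodic_character by (simp add: periodic_T2_def g_def)
  have "fint g \<zeta> = fint f \<zeta>" for \<zeta>
  proof -
    have "uniform_limit cell (\<lambda>F z. \<Sum>\<xi>\<in>F. a \<xi> * character \<xi> z * character \<zeta> z)
        (\<lambda>z. \<Sum>\<^sub>\<infinity>\<xi>. a \<xi> * character \<xi> z * character \<zeta> z) (finite_subsets_at_top UNIV)"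
      by (rule Weierstrass_m_test_general[OF _ a]) (simp add: norm_mult)
    moreover have "(\<lambda>z. \<Sum>\<^sub>\<infinity>\<xi>. a \<xi> * character \<xi> z * character \<zeta> z) = (\<lambda>z. g z * character \<zeta> z)"
      by (simp add: g_def infsum_cmult_left')
    ultimately have ul: "uniform_limit cell (\<lambda>F z. \<Sum>\<xi>\<in>F. a \<xi> * character \<xi> z * character \<zeta> z)
        (\<lambda>z. g z * character \<zeta> z) (finite_subsets_at_top UNIV)" by simp
    have ck: "continuous_on cell (\<lambda>z. \<Sum>\<xi>\<in>F. a \<xi> * character \<xi> z * character \<zeta> z)" for F
      by (intro continuous_intros continuous_character)
    obtain I J where IJ: "\<And>F. ((\<lambda>z. \<Sum>\<xi>\<in>F. a \<xi> * character \<xi> z * character \<zeta> z) has_integral I F) cell"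
        "((\<lambda>z. g z * character \<zeta> z) has_integral J) cell" "(I \<longlongrightarrow> J) (finite_subsets_at_top UNIV)"
      by (rule uniform_limit_integral_cbox[OF ul ck finite_subsets_at_top_neq_bot]) blast
    have "((\<lambda>z. a \<xi> * (character \<xi> z * character \<zeta> z)) has_integral a \<xi> * fint (character \<xi>) \<zeta>) cell" for \<xi>
      unfolding fint_def
      by (intro has_integral_mult_right integrable_integral integrable_cell continuous_intros continuous_character)
    then have "((\<lambda>z. \<Sum>\<xi>\<in>F. a \<xi> * character \<xi> z * character \<zeta> z) has_integral
        (\<Sum>\<xi>\<in>F. a \<xi> * fint (character \<xi>) \<zeta>)) cell" if "finite F" for F
      unfolding mult.assoc by (intro has_integral_sum that)
    then have "I F = (\<Sum>\<xi>\<in>F. a \<xi> * fint (character \<xi>) \<zeta>)" if "finite F" for F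
      by (rule has_integral_unique[OF IJ(1)]) (rule that)
    then have "\<forall>\<^sub>F F in finite_subsets_at_top UNIV. I F = (\<Sum>\<xi>\<in>F. a \<xi> * fint (character \<xi>) \<zeta>)"
      by (rule eventually_finite_subsets_at_top_weakI)
    then have "((\<lambda>\<xi>. a \<xi> * fint (character \<xi>) \<zeta>) has_sum J) UNIV"
      unfolding has_sum_def using IJ(3) by (rule Lim_transform_eventually[rotated])
    \<comment> \<open>By orthogonality only the term at \<open>- \<zeta>\<close> survives.\<close>
    moreover have "((\<lambda>\<xi>. a \<xi> * fint (character \<xi>) \<zeta>) has_sum fint f \<zeta>) UNIV"
      by (rule has_sum_finite_neutralI[of "{- \<zeta>}"]) (auto simp: fint_character a_def)
    ultimately have "J = fint f \<zeta>" by (rule has_sum_unique)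
    then show ?thesis using IJ(2) by (simp add: fint_def integral_unique)
  qed
  then have zero: "fint (\<lambda>z. f z + (-1) * g z) \<zeta> = 0" for \<zeta>
    by (subst fint_lincomb[OF smooth_T2_D(3)[OF f] contg]) simp
  have "periodic_T2 (\<lambda>z. f z + (-1) * g z)"
    using smooth_T2_D(1)[OF f] perg by (simp add: periodic_T2_def)
  moreover have "continuous_on UNIV (\<lambda>z. f z + (-1) * g z)"
    by (intro continuous_on_add continuous_on_mult continuous_on_const smooth_T2_D(3)[OF f] contg)
  ultimately have "f z + (-1) * g z = 0" by (rule fourier_uniqueness[OF _ _ zero])
  then have "f z = g z" by simp
  then show ?thesis using has_sum_infsum[OF summ[of z]] by (simp add: a_def g_def)
qed

section \<open>Distributions as Fourier series\<close>

lemma infsum_tail_tendsto_0: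
  fixes f :: "'a \<Rightarrow> real"
  assumes "f summable_on UNIV"
  shows "((\<lambda>F. infsum f (UNIV - F)) \<longlongrightarrow> 0) (finite_subsets_at_top UNIV)"
proof -
  have "((\<lambda>F. infsum f UNIV - sum f F) \<longlongrightarrow> infsum f UNIV - infsum f UNIV) (finite_subsets_at_top UNIV)"
    by (intro tendsto_diff tendsto_const infsum_tendsto assms)
  moreover have "\<forall>\<^sub>F F in finite_subsets_at_top UNIV. infsum f UNIV - sum f F = infsum f (UNIV - F)"
    by (rule eventually_finite_subsets_at_top_weakI) (simp add: infsum_Diff assms)
  ultimately show ?thesis by (simp add: tendsto_cong)
qed

lemma abs_fst_snd_le_jb: "\<bar>of_int (fst \<xi>)\<bar> \<le> jb \<xi>" "\<bar>of_int (snd \<xi>)\<bar> \<le> jb \<xi>"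
proof -
  have "\<bar>t\<bar> \<le> 1 + t\<^sup>2" for t :: real
    using zero_le_power2[of "\<bar>t\<bar> - 1"] by (simp add: power2_diff)
  then show "\<bar>of_int (fst \<xi>)\<bar> \<le> jb \<xi>" "\<bar>of_int (snd \<xi>)\<bar> \<le> jb \<xi>"
    unfolding jb_def by (smt (verit) zero_le_power2)+
qed

text \<open>Convergence of the Fourier series in each \<open>C^N\<close> norm. Inversion is applied
  to each derivative of \<open>f\<close>; its coefficients are those of \<open>f\<close> times
  monomials of degree at most \<open>N\<close>, dominated by \<open>jb \<xi> ^ N\<close>.\<close>

lemma Cm_norm_fourier_tail:
  assumes f: "f \<in> smooth_T2" and fin: "finite F"
  shows "Cm_norm N (\<lambda>z. f z + (-1) * (\<Sum>\<xi>\<in>F. fint f (- \<xi>) / (2 * pi)\<^sup>2 * character \<xi> z))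
    \<le> (real N + 1)\<^sup>2 * infsum (\<lambda>\<xi>. jb \<xi> ^ N * cmod (fint f (- \<xi>) / (2 * pi)\<^sup>2)) (UNIV - F)"
proof -
  define a where "a \<xi> = fint f (- \<xi>) / (2 * pi)\<^sup>2" for \<xi>
  have sum: "(\<lambda>\<xi>. jb \<xi> ^ N * cmod (a \<xi>)) summable_on UNIV - F"
    unfolding a_def by (rule summable_on_subset_banach[OF fint_uminus_summable[OF f]]) auto
  have "cmod (pd i j (\<lambda>z. f z + (-1) * (\<Sum>\<xi>\<in>F. a \<xi> * character \<xi> z)) z)
      \<le> infsum (\<lambda>\<xi>. jb \<xi> ^ N * cmod (a \<xi>)) (UNIV - F)" if ij: "i + j \<le> N" for i j z
  proof -
    define b where "b \<xi> = (\<i> * of_int (fst \<xi>)) ^ i * (\<i> * of_int (snd \<xi>)) ^ j * a \<xi> * character \<xi> z" for \<xi>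
    have "(b has_sum pd i j f z) UNIV"
      using fourier_inversion[OF smooth_pd[OF f, of i j], of z]
      by (simp add: b_def[abs_def] a_def fint_pd[OF f] mult_ac)
    moreover have "(b has_sum sum b F) F" using fin by simp
    ultimately have *: "(b has_sum (pd i j f z - sum b F)) (UNIV - F)"
      by (rule has_sum_Diff) simp
    have "pd i j (\<lambda>z. f z + (-1) * (\<Sum>\<xi>\<in>F. a \<xi> * character \<xi> z)) z = pd i j f z - sum b F"
      by (subst pd_lincomb[OF f smooth_sum[OF fin]]) (simp add: pd_sum[OF fin] b_def)
    moreover have "cmod (b \<xi>) \<le> jb \<xi> ^ N * cmod (a \<xi>)" for \<xi>
    proof -
      have "\<bar>of_int (fst \<xi>)\<bar> ^ i * \<bar>of_int (snd \<xi>)\<bar> ^ j \<le> jb \<xi> ^ i * jb \<xi> ^ j"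
        by (intro mult_mono power_mono abs_fst_snd_le_jb) (auto intro: less_imp_le[OF jb_pos] zero_le_power)
      also have "\<dots> \<le> jb \<xi> ^ N"
        unfolding power_add[symmetric] by (rule power_increasing[OF ij jb_ge_1])
      finally show ?thesis by (simp add: b_def norm_mult norm_power mult_right_mono)
    qed
    moreover have "cmod (pd i j f z - sum b F) \<le> infsum (\<lambda>\<xi>. jb \<xi> ^ N * cmod (a \<xi>)) (UNIV - F)"
      by (rule norm_infsum_le[OF * has_sum_infsum[OF sum]]) (rule calculation(2))
    ultimately show ?thesis by simp
  qed
  moreover have "0 \<le> infsum (\<lambda>\<xi>. jb \<xi> ^ N * cmod (a \<xi>)) (UNIV - F)"
    by (rule infsum_nonneg) (use jb_pos[THEN less_imp_le] in auto)
  ultimately show ?thesis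
    unfolding a_def by (rule Cm_norm_leI)
qed

text \<open>The action on \<open>f\<close> of the formal series with coefficients \<open>c\<close>:
  \<open>fint f \<xi>\<close> is the pairing of \<open>character \<xi>\<close> with
  \<open>f\<close>.\<close>

definition synth :: "(int \<times> int \<Rightarrow> complex) \<Rightarrow> dist" where
  "synth c = (\<lambda>f. if f \<in> smooth_T2 then \<Sum>\<^sub>\<infinity>\<xi>. c \<xi> * fint f \<xi> else 0)"

lemma distributions_D:
  assumes "u \<in> distributions"
  shows "f \<notin> smooth_T2 \<Longrightarrow> u f = 0"
    "f \<in> smooth_T2 \<Longrightarrow> g \<in> smooth_T2 \<Longrightarrow> u (\<lambda>z. f z + g z) = u f + u g"
    "f \<in> smooth_T2 \<Longrightarrow> u (\<lambda>z. c * f z) = c * u f"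
    "\<exists>C N. \<forall>f\<in>smooth_T2. cmod (u f) \<le> C * Cm_norm N f"
  using assms by (auto simp: distributions_def)

lemma smooth_cmult: "f \<in> smooth_T2 \<Longrightarrow> (\<lambda>z. c * f z) \<in> smooth_T2"
  using smooth_lincomb[OF smooth_character[of 0 0], of f c] by simp

lemma distribution_sum:
  assumes u: "u \<in> distributions" and "finite F"
  shows "u (\<lambda>z. \<Sum>\<xi>\<in>F. c \<xi> * character \<xi> z) = (\<Sum>\<xi>\<in>F. c \<xi> * u (character \<xi>))"
  using assms(2)
proof (induction F)
  case empty
  show ?case using distributions_D(3)[OF u smooth_char[of 0], of 0] by simp
next
  case (insert \<xi> F)
  then show ?case
    using distributions_D(2)[OF u smooth_character smooth_sum[OF insert.hyps(1)], of "c \<xi>" \<xi> c]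
      distributions_D(3)[OF u smooth_char[of \<xi>], of "c \<xi>"] by simp
qed

text \<open>Continuity for one \<open>C^N\<close> norm lets \<open>u\<close> pass through the
  Fourier series of a test function.\<close>

lemma distribution_eq_synth:
  assumes u: "u \<in> distributions"
  shows "u = synth (fourier_coeff u)"
proof
  fix f
  show "u f = synth (fourier_coeff u) f"
  proof (cases "f \<in> smooth_T2")
    case False
    then show ?thesis by (simp add: synth_def distributions_D(1)[OF u])
  next
    case f: True
    define a where "a \<xi> = fint f (- \<xi>) / (2 * pi)\<^sup>2" for \<xi>
    obtain C N where CN: "\<And>f. f \<in> smooth_T2 \<Longrightarrow> cmod (u f) \<le> C * Cm_norm N f"
      using distributions_D(4)[OF u] by blast
    let ?t = "\<lambda>F. infsum (\<lambda>\<xi>. jb \<xi> ^ N * cmod (fint f (- \<xi>) / (2 * pi)\<^sup>2)) (UNIV - F)"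
    have bound: "cmod ((\<Sum>\<xi>\<in>F. a \<xi> * u (character \<xi>)) - u f) \<le> \<bar>C\<bar> * (real N + 1)\<^sup>2 * ?t F"
      if "finite F" for F
    proof -
      let ?S = "\<lambda>z. \<Sum>\<xi>\<in>F. a \<xi> * character \<xi> z"
      note s = smooth_sum[OF that, of a]
      have sm: "(\<lambda>z. f z + (-1) * ?S z) \<in> smooth_T2" by (rule smooth_lincomb[OF f s])
      have "u (\<lambda>z. f z + (-1) * ?S z) = u f + (-1) * u ?S"
        using distributions_D(2)[OF u f smooth_cmult[OF s], of "-1"] distributions_D(3)[OF u s, of "-1"]
        by simp
      then have "cmod ((\<Sum>\<xi>\<in>F. a \<xi> * u (character \<xi>)) - u f) = cmod (u (\<lambda>z. f z + (-1) * ?S z))"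
        by (simp add: distribution_sum[OF u that] norm_minus_commute)
      also have "\<dots> \<le> C * Cm_norm N (\<lambda>z. f z + (-1) * ?S z)" by (rule CN[OF sm])
      also have "\<dots> \<le> \<bar>C\<bar> * Cm_norm N (\<lambda>z. f z + (-1) * ?S z)"
        by (intro mult_right_mono Cm_norm_nonneg[OF sm]) auto
      also have "\<dots> \<le> \<bar>C\<bar> * ((real N + 1)\<^sup>2 * ?t F)"
        using Cm_norm_fourier_tail[OF f that, of N] by (intro mult_left_mono) (simp_all add: a_def)
      finally show ?thesis by (simp add: mult_ac)
    qed
    have "((\<lambda>F. \<bar>C\<bar> * (real N + 1)\<^sup>2 * ?t F) \<longlongrightarrow> 0) (finite_subsets_at_top UNIV)"
      by (intro tendsto_mult_right_zero infsum_tail_tendsto_0 fint_uminus_summable f)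
    then have "((\<lambda>F. (\<Sum>\<xi>\<in>F. a \<xi> * u (character \<xi>)) - u f) \<longlongrightarrow> 0) (finite_subsets_at_top UNIV)"
      by (rule Lim_null_comparison[rotated])
        (rule eventually_finite_subsets_at_top_weakI, rule bound)
    then have "((\<lambda>\<xi>. a \<xi> * u (character \<xi>)) has_sum u f) UNIV"
      unfolding has_sum_def by (rule LIM_zero_cancel)
    then have "u f = (\<Sum>\<^sub>\<infinity>\<xi>. a \<xi> * u (character \<xi>))" by (simp add: infsumI)
    \<comment> \<open>The pairing sees \<open>character (- \<xi>)\<close> in the coefficient at
      \<open>\<xi>\<close>, so the sum is reflected.\<close>
    also have "\<dots> = (\<Sum>\<^sub>\<infinity>\<xi>. a (- \<xi>) * u (character (- \<xi>)))"
      using infsum_reindex_bij_betw[OF bij_uminus, of "\<lambda>\<xi>. a \<xi> * u (character \<xi>)"] by simp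
    also have "\<dots> = synth (fourier_coeff u) f"
      by (simp add: synth_def f a_def fourier_coeff_def mult_ac)
    finally show ?thesis .
  qed
qed

lemma synth_distribution:
  assumes c: "polybdd c"
  shows "synth c \<in> distributions"
proof -
  note sm = polybdd_summable[OF c]
  have lin: "fint (\<lambda>z. f z + d * g z) \<xi> = fint f \<xi> + d * fint g \<xi>"
    if "f \<in> smooth_T2" "g \<in> smooth_T2" for f g d \<xi>
    by (rule fint_lincomb) (use that smooth_T2_D(3) in auto)
  have add: "synth c (\<lambda>z. f z + g z) = synth c f + synth c g" if "f \<in> smooth_T2" "g \<in> smooth_T2" for f g
    using smooth_lincomb[OF that, of 1] lin[OF that, of 1] sm(2)[OF that(1)] sm(2)[OF that(2)] that
    by (simp add: synth_def distrib_left infsum_add)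
  have scale: "synth c (\<lambda>z. d * f z) = d * synth c f" if f: "f \<in> smooth_T2" for d f
  proof -
    have "fint (\<lambda>z. d * f z) \<xi> = d * fint f \<xi>" for \<xi>
      using lin[OF smooth_character[of 0 0] f, of d \<xi>] by (simp add: fint_def)
    then show ?thesis
      using smooth_cmult[OF f] f by (simp add: synth_def mult.left_commute[of _ d] infsum_cmult_right')
  qed
  obtain K n where K: "\<And>\<xi>. cmod (c \<xi>) \<le> K * jb \<xi> ^ n" using c by (auto simp: polybdd_def)
  have "cmod (synth c f) \<le> (K * (3 ^ (n + 3) * (2 * pi)\<^sup>2) * infsum (\<lambda>\<xi>. 1 / jb \<xi> ^ 2) UNIV) * Cm_norm (2 * (n + 2)) f"
    if f: "f \<in> smooth_T2" for f
  proof -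
    have "cmod (synth c f) = cmod (\<Sum>\<^sub>\<infinity>\<xi>. c \<xi> * fint f \<xi>)" using f by (simp add: synth_def)
    also have "\<dots> \<le> (\<Sum>\<^sub>\<infinity>\<xi>. (K * (3 ^ (n + 3) * (2 * pi)\<^sup>2) * Cm_norm (2 * (n + 2)) f) * (1 / jb \<xi> ^ 2))"
      by (rule norm_infsum_le[OF has_sum_infsum[OF sm(2)[OF f]]
            has_sum_infsum[OF summable_on_cmult_right[OF summable_on_jb]] polybdd_fint_bound[OF K f]])
    also have "\<dots> = (K * (3 ^ (n + 3) * (2 * pi)\<^sup>2) * infsum (\<lambda>\<xi>. 1 / jb \<xi> ^ 2) UNIV) * Cm_norm (2 * (n + 2)) f"
      unfolding infsum_cmult_right' by (simp add: mult_ac)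
    finally show ?thesis .
  qed
  then have "\<exists>C N. \<forall>f\<in>smooth_T2. cmod (synth c f) \<le> C * Cm_norm N f" by blast
  with add scale show ?thesis by (auto simp: distributions_def synth_def)
qed

text \<open>Against a character the sum has a single nonzero term, whatever the growth of
  \<open>c\<close>.\<close>

lemma fourier_coeff_synth: "fourier_coeff (synth c) = c"
proof
  fix \<xi>
  have "((\<lambda>\<zeta>. c \<zeta> * fint (character (- \<xi>)) \<zeta>) has_sum c \<xi> * (2 * pi)\<^sup>2) UNIV"
    by (rule has_sum_finite_neutralI[of "{\<xi>}"]) (auto simp: fint_character)
  then show "fourier_coeff (synth c) \<xi> = c \<xi>"
    by (simp add: fourier_coeff_def synth_def smooth_char infsumI)
qed

lemma wave_op_synth:
  assumes c: "polybdd c"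
  shows "wave_op \<eta> (synth c) = synth (\<lambda>\<xi>. wave_symbol \<eta> \<xi> * c \<xi>)"
proof
  fix f
  show "wave_op \<eta> (synth c) f = synth (\<lambda>\<xi>. wave_symbol \<eta> \<xi> * c \<xi>) f"
  proof (cases "f \<in> smooth_T2")
    case False
    then show ?thesis by (simp add: wave_op_def dist_pderiv1_def dist_pderiv2_def synth_def)
  next
    case f: True
    note s1 = smooth_pderiv1[OF smooth_pderiv1[OF f]] and s2 = smooth_pderiv2[OF smooth_pderiv2[OF f]]
    have "wave_op \<eta> (synth c) f = synth c (pderiv1 (pderiv1 f)) - of_real (\<eta>\<^sup>2) * synth c (pderiv2 (pderiv2 f))"
      using f smooth_pderiv1 smooth_pderiv2
      by (simp add: wave_op_def dist_pderiv1_def dist_pderiv2_def)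
    also have "\<dots> = (\<Sum>\<^sub>\<infinity>\<xi>. c \<xi> * fint (pderiv1 (pderiv1 f)) \<xi>) +
        (\<Sum>\<^sub>\<infinity>\<xi>. - of_real (\<eta>\<^sup>2) * (c \<xi> * fint (pderiv2 (pderiv2 f)) \<xi>))"
      using s1 s2 by (simp only: infsum_cmult_right' synth_def if_True) simp
    also have "\<dots> = (\<Sum>\<^sub>\<infinity>\<xi>. c \<xi> * fint (pderiv1 (pderiv1 f)) \<xi> +
        - of_real (\<eta>\<^sup>2) * (c \<xi> * fint (pderiv2 (pderiv2 f)) \<xi>))"
      by (rule infsum_add[symmetric])
        (intro summable_on_cmult_right polybdd_summable c s1 s2)+
    also have "\<dots> = (\<Sum>\<^sub>\<infinity>\<xi>. wave_symbol \<eta> \<xi> * c \<xi> * fint f \<xi>)"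
      using f smooth_pderiv1[OF f] smooth_pderiv2[OF f]
      by (intro infsum_cong) (simp add: fint_pderiv wave_symbol_def power2_eq_square algebra_simps)
    finally show ?thesis using f by (simp add: synth_def)
  qed
qed

section \<open>Lower bounds for the symbol and Diophantine approximation\<close>

definition psym :: "real \<Rightarrow> int \<times> int \<Rightarrow> real" where
  "psym \<eta> \<xi> = - (of_int (fst \<xi>))\<^sup>2 + \<eta>\<^sup>2 * (of_int (snd \<xi>))\<^sup>2"

text \<open>\<open>jb\<close> is the square of the bracket, so the exponent is half of
  \<open>2 - r\<close>, the order minus the loss.\<close>

definition symbol_bound :: "real \<Rightarrow> real \<Rightarrow> bool" where
  "symbol_bound \<eta> r \<longleftrightarrow> (\<exists>c>0. \<forall>\<xi>. psym \<eta> \<xi> \<noteq> 0 \<longrightarrow> c * jb \<xi> powr (1 - r / 2) \<le> \<bar>psym \<eta> \<xi>\<bar>)"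

definition approximants :: "real \<Rightarrow> real \<Rightarrow> real set" where
  "approximants \<eta> \<mu> = {x. \<exists>p q :: int. q \<noteq> 0 \<and> x = of_int p / of_int q \<and>
                  0 < \<bar>\<eta> - x\<bar> \<and> \<bar>\<eta> - x\<bar> < 1 / \<bar>of_int q\<bar> powr \<mu>}"

text \<open>Stated with \<open>\<bar>a\<bar>\<close> because the exponent \<open>1 - r / 2\<close>
  may have either sign.\<close>

lemma powr_comparable:
  fixes u v K a :: real
  assumes "0 < u" "0 < v" "1 \<le> K" "u \<le> K * v" "v \<le> K * u"
  shows "K powr (- \<bar>a\<bar>) * v powr a \<le> u powr a"
proof (cases "a \<ge> 0")
  case True
  have "K powr (- a) * v powr a = (v / K) powr a"
    using assms True by (simp add: powr_divide powr_minus field_simps)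
  also have "\<dots> \<le> u powr a"
    using assms True by (intro powr_mono2) (auto simp: field_simps)
  finally show ?thesis using True by simp
next
  case False
  have "K powr a * v powr a = (K * v) powr a"
    using assms by (simp add: powr_mult)
  also have "\<dots> \<le> u powr a"
    using assms False by (intro powr_mono2') auto
  finally show ?thesis using False by simp
qed

text \<open>The symbol is even in each coordinate. With absolute values and
  \<open>\<eta> > 0\<close> the second factor is nonnegative, so cancellation occurs only in the
  first.\<close>

lemma psym_factor: "psym \<eta> \<xi> = (\<eta> * \<bar>of_int (snd \<xi>)\<bar> - \<bar>of_int (fst \<xi>)\<bar>) * (\<eta> * \<bar>of_int (snd \<xi>)\<bar> + \<bar>of_int (fst \<xi>)\<bar>)"
  by (simp add: psym_def algebra_simps power2_eq_square)

text \<open>Where \<open>x \<ge> 2 * \<eta> * y\<close> the symbol is elliptic, comparable to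
  \<open>jb\<close>. Elsewhere \<open>y^2\<close> is comparable to \<open>jb\<close>, and the
  distance of \<open>t = x / y\<close> from \<open>\<eta>\<close> decides.\<close>

lemma symbol_bound_of_finite:
  assumes "\<eta> > 0" "\<mu> > 0" and fin: "finite (approximants \<eta> \<mu>)"
  shows "symbol_bound \<eta> \<mu>"
proof -
  \<comment> \<open>The least distance of the exceptional fractions from \<open>\<eta>\<close>.
    Inserting 1 keeps the set nonempty and gives \<open>d \<le> 1\<close>, so
    \<open>d * y powr (- \<mu>)\<close> bounds the distance from below for exceptional and ordinary
    fractions alike.\<close>
  define d where "d = Min (insert 1 ((\<lambda>x. \<bar>\<eta> - x\<bar>) ` approximants \<eta> \<mu>))"
  have d: "0 < d" "d \<le> 1" "\<And>x. x \<in> approximants \<eta> \<mu> \<Longrightarrow> d \<le> \<bar>\<eta> - x\<bar>"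
    using fin by (auto simp: d_def approximants_def)
  define a where "a = 1 - \<mu> / 2"
  \<comment> \<open>From \<open>jb = 1 + x^2 + y^2\<close> with \<open>x < 2 * \<eta> * y\<close>
    and \<open>y \<ge> 1\<close>.\<close>
  define K where "K = 2 + 4 * \<eta>\<^sup>2"
  have K: "1 \<le> K" by (simp add: K_def)
  \<comment> \<open>The inner minimum serves the elliptic region, the last entry the region near the
    lines.\<close>
  define c where "c = min (min (1 / 4) (\<eta>\<^sup>2)) (d * \<eta> * K powr (- \<bar>a\<bar>))"
  have c: "0 < c" using d assms K by (simp add: c_def)
  have "c * jb \<xi> powr a \<le> \<bar>psym \<eta> \<xi>\<bar>" if nz: "psym \<eta> \<xi> \<noteq> 0" for \<xi>
  proof -
    define x where "x = \<bar>of_int (fst \<xi>) :: real\<bar>"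
    define y where "y = \<bar>of_int (snd \<xi>) :: real\<bar>"
    have jb: "jb \<xi> = 1 + (x\<^sup>2 + y\<^sup>2)" by (simp add: jb_def x_def y_def)
    have p: "psym \<eta> \<xi> = (\<eta> * y - x) * (\<eta> * y + x)" unfolding psym_factor x_def y_def ..
    have xy: "0 \<le> x" "0 \<le> y" by (simp_all add: x_def y_def)
    show ?thesis
    proof (cases "x \<ge> 2 * \<eta> * y")
      case True
      have "x \<noteq> 0"
      proof
        assume "x = 0"
        with True xy assms have "y = 0" by (simp add: mult_le_0_iff)
        with \<open>x = 0\<close> p nz show False by simp
      qed
      then have "1 \<le> x" unfolding x_def by (cases "fst \<xi>") auto
      then have x1: "1 \<le> x\<^sup>2" by simp
      have yx: "4 * (\<eta>\<^sup>2 * y\<^sup>2) \<le> x\<^sup>2"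
        using power_mono[OF True, of 2] xy assms by (simp add: power_mult_distrib)
      have "jb \<xi> powr a \<le> jb \<xi> powr 1"
        using assms jb_ge_1[of \<xi>] by (intro powr_mono) (auto simp: a_def)
      then have "jb \<xi> powr a \<le> jb \<xi>" using jb_pos[of \<xi>] by simp
      then have "c * jb \<xi> powr a \<le> c * jb \<xi>" using c by (intro mult_left_mono) auto
      also have "\<dots> = c * (1 + x\<^sup>2) + c * y\<^sup>2" by (simp add: jb algebra_simps)
      also have "\<dots> \<le> 1 / 4 * (1 + x\<^sup>2) + \<eta>\<^sup>2 * y\<^sup>2"
        by (intro add_mono mult_right_mono) (auto simp: c_def)
      also have "\<dots> \<le> 3 / 4 * x\<^sup>2" using x1 yx by (simp add: distrib_left)
      also have "\<dots> \<le> x\<^sup>2 - \<eta>\<^sup>2 * y\<^sup>2" using yx by linarith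
      also have "\<dots> = - psym \<eta> \<xi>" by (simp add: p algebra_simps power2_eq_square)
      also have "\<dots> \<le> \<bar>psym \<eta> \<xi>\<bar>" by simp
      finally show ?thesis .
    next
      case False
      then have "y \<noteq> 0" using xy by auto
      then have q: "snd \<xi> \<noteq> 0" unfolding y_def by auto
      then have y1: "1 \<le> y" unfolding y_def by (cases "snd \<xi>") auto
      define t where "t = x / y"
      have t: "t = of_int \<bar>fst \<xi>\<bar> / of_int \<bar>snd \<xi>\<bar>" by (simp add: t_def x_def y_def)
      have pt: "psym \<eta> \<xi> = y\<^sup>2 * (\<eta> - t) * (\<eta> + t)"
        using y1 by (simp add: p t_def field_simps power2_eq_square)
      have t0: "0 \<le> t" using xy by (simp add: t_def)
      have ne: "0 < \<bar>\<eta> - t\<bar>" using nz pt by auto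
      have "d * y powr (- \<mu>) \<le> \<bar>\<eta> - t\<bar>"
      proof (cases "\<bar>\<eta> - t\<bar> < 1 / y powr \<mu>")
        case True
        then have "t \<in> approximants \<eta> \<mu>"
          unfolding approximants_def using ne t q
          by (intro CollectI exI[of _ "\<bar>fst \<xi>\<bar>"] exI[of _ "\<bar>snd \<xi>\<bar>"]) (auto simp: y_def)
        then have "d \<le> \<bar>\<eta> - t\<bar>" by (rule d)
        moreover have "y powr (- \<mu>) \<le> 1"
          using powr_mono[of "- \<mu>" 0 y] y1 assms by simp
        then have "d * y powr (- \<mu>) \<le> d * 1" using d(1) by (intro mult_left_mono) auto
        ultimately show ?thesis by simp
      next
        case False
        have "d * y powr (- \<mu>) \<le> 1 * y powr (- \<mu>)" using d by (intro mult_right_mono) auto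
        with False show ?thesis by (simp add: powr_minus_divide)
      qed
      then have "y\<^sup>2 * (d * y powr (- \<mu>)) * \<eta> \<le> y\<^sup>2 * \<bar>\<eta> - t\<bar> * (\<eta> + t)"
        using t0 assms(1) y1 by (intro mult_mono mult_left_mono) auto
      also have "\<dots> = \<bar>psym \<eta> \<xi>\<bar>" using t0 assms(1) by (simp add: pt abs_mult)
      finally have 1: "d * \<eta> * (y\<^sup>2 * y powr (- \<mu>)) \<le> \<bar>psym \<eta> \<xi>\<bar>" by (simp add: mult_ac)
      have "y\<^sup>2 * y powr (- \<mu>) = (y\<^sup>2) powr a"
        using y1 by (simp add: a_def powr_powr flip: powr_add powr_numeral)
      moreover have "K powr (- \<bar>a\<bar>) * jb \<xi> powr a \<le> (y\<^sup>2) powr a"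
      proof (rule powr_comparable[OF _ jb_pos K])
        show "0 < y\<^sup>2" using y1 by simp
        have "y\<^sup>2 \<le> 1 * jb \<xi>" by (simp add: jb)
        also have "\<dots> \<le> K * jb \<xi>" using K jb_pos[of \<xi>] by (intro mult_right_mono) auto
        finally show "y\<^sup>2 \<le> K * jb \<xi>" .
        have "x\<^sup>2 \<le> (2 * \<eta> * y)\<^sup>2" using False xy by (intro power_mono) auto
        moreover have "1 \<le> y\<^sup>2" using y1 by simp
        ultimately show "jb \<xi> \<le> K * y\<^sup>2" by (simp add: jb K_def algebra_simps power_mult_distrib)
      qed
      ultimately have "d * \<eta> * (K powr (- \<bar>a\<bar>) * jb \<xi> powr a) \<le> \<bar>psym \<eta> \<xi>\<bar>"
        using 1 d(1) assms(1) by (smt (verit) mult_left_mono mult_pos_pos)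
      moreover have "c * jb \<xi> powr a \<le> d * \<eta> * K powr (- \<bar>a\<bar>) * jb \<xi> powr a"
        by (intro mult_right_mono) (auto simp: c_def)
      ultimately show ?thesis by (simp add: mult.assoc)
    qed
  qed
  with c show ?thesis unfolding symbol_bound_def a_def by blast
qed

text \<open>For an approximant with denominator \<open>y\<close>, the bound gives
  \<open>e * y powr (- r) \<le> \<bar>\<eta> - x\<bar>\<close>, while the distance is below
  \<open>y powr (- \<mu>)\<close>. As \<open>r < \<mu>\<close>, this bounds \<open>y\<close>, and
  then the numerator.\<close>

lemma finite_of_symbol_bound:
  assumes "\<eta> > 0" "0 \<le> r" "r < \<mu>" and bound: "symbol_bound \<eta> r"
  shows "finite (approximants \<eta> \<mu>)"
proof -
  obtain c where c: "0 < c" "\<And>\<xi>. psym \<eta> \<xi> \<noteq> 0 \<Longrightarrow> c * jb \<xi> powr (1 - r / 2) \<le> \<bar>psym \<eta> \<xi>\<bar>"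
    using bound by (auto simp: symbol_bound_def)
  define a where "a = 1 - r / 2"
  define K where "K = 2 + (\<eta> + 1)\<^sup>2"
  have K: "1 \<le> K" by (simp add: K_def)
  \<comment> \<open>The divisor bounds \<open>\<bar>\<eta> + x\<bar>\<close>, since approximants lie
    within 1 of \<open>\<eta>\<close>.\<close>
  define e where "e = c * K powr (- \<bar>a\<bar>) / (2 * \<eta> + 1)"
  have e: "0 < e" using c K assms by (simp add: e_def)
  define Q where "Q = (1 / e) powr (1 / (\<mu> - r))"
  define B where "B = nat \<lceil>(\<eta> + 1) * Q\<rceil> + nat \<lceil>Q\<rceil>"
  \<comment> \<open>At \<open>x = - \<eta>\<close>, possible for rational \<open>\<eta>\<close>, the
    symbol vanishes and the bound is silent; this one value is added by hand.\<close>
  have "approximants \<eta> \<mu> \<subseteq> insert (- \<eta>) ((\<lambda>(p, q). of_int p / of_int q) ` ({- int B..int B} \<times> {- int B..int B}))"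
  proof
    fix x assume "x \<in> approximants \<eta> \<mu>"
    then obtain p q :: int where pq: "q \<noteq> 0" "x = of_int p / of_int q" "0 < \<bar>\<eta> - x\<bar>"
      "\<bar>\<eta> - x\<bar> < 1 / \<bar>of_int q\<bar> powr \<mu>"
      by (auto simp: approximants_def)
    define y where "y = \<bar>of_int q :: real\<bar>"
    have y1: "1 \<le> y" unfolding y_def using pq(1) by (cases q) auto
    have "1 \<le> y powr \<mu>" using y1 assms by (intro ge_one_powr_ge_zero) auto
    then have "1 / y powr \<mu> \<le> 1" using y1 by (simp add: divide_le_eq)
    with pq(4) have close: "\<bar>\<eta> - x\<bar> < 1" by (simp add: y_def)
    have xa: "\<bar>x\<bar> \<le> \<eta> + 1" "\<bar>\<eta> + x\<bar> \<le> 2 * \<eta> + 1" using close assms(1) by linarith+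
    have p: "of_int p = x * of_int q" using pq by simp
    have psym: "psym \<eta> (p, q) = y\<^sup>2 * (\<eta> - x) * (\<eta> + x)"
      by (simp add: psym_def p y_def algebra_simps power2_eq_square)
    have jb: "jb (p, q) = 1 + (x\<^sup>2 * y\<^sup>2 + y\<^sup>2)" by (simp add: jb_def p y_def power_mult_distrib)
    show "x \<in> insert (- \<eta>) ((\<lambda>(p, q). of_int p / of_int q) ` ({- int B..int B} \<times> {- int B..int B}))"
    proof (cases "x = - \<eta>")
      case False
      then have "psym \<eta> (p, q) \<noteq> 0" using psym pq(3) y1 by auto
      then have "c * jb (p, q) powr a \<le> \<bar>psym \<eta> (p, q)\<bar>" unfolding a_def by (rule c)
      also have "\<dots> = y\<^sup>2 * \<bar>\<eta> - x\<bar> * \<bar>\<eta> + x\<bar>" by (simp add: psym abs_mult)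
      also have "\<dots> \<le> y\<^sup>2 * \<bar>\<eta> - x\<bar> * (2 * \<eta> + 1)" by (intro mult_left_mono xa) auto
      finally have 1: "c * jb (p, q) powr a \<le> y\<^sup>2 * \<bar>\<eta> - x\<bar> * (2 * \<eta> + 1)" .
      have "K powr (- \<bar>a\<bar>) * (y\<^sup>2) powr a \<le> jb (p, q) powr a"
      proof (rule powr_comparable[OF jb_pos _ K])
        show "0 < y\<^sup>2" using y1 by simp
        have "y\<^sup>2 \<le> 1 * jb (p, q)" by (simp add: jb)
        also have "\<dots> \<le> K * jb (p, q)" using K jb_pos[of "(p, q)"] by (intro mult_right_mono) auto
        finally show "y\<^sup>2 \<le> K * jb (p, q)" .
        have "x\<^sup>2 \<le> (\<eta> + 1)\<^sup>2" using power_mono[OF xa(1), of 2] by simp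
        then have "x\<^sup>2 * y\<^sup>2 \<le> (\<eta> + 1)\<^sup>2 * y\<^sup>2" by (intro mult_right_mono) auto
        moreover have "1 \<le> y\<^sup>2" using y1 by simp
        ultimately show "jb (p, q) \<le> K * y\<^sup>2" unfolding jb K_def distrib_right by linarith
      qed
      then have "c * (K powr (- \<bar>a\<bar>) * (y\<^sup>2) powr a) \<le> c * jb (p, q) powr a"
        using c(1) by (intro mult_left_mono) auto
      with 1 have "c * (K powr (- \<bar>a\<bar>) * (y\<^sup>2) powr a) \<le> y\<^sup>2 * \<bar>\<eta> - x\<bar> * (2 * \<eta> + 1)" by linarith
      moreover have "(y\<^sup>2) powr a = y\<^sup>2 * y powr (- r)"
        using y1 by (simp add: a_def powr_powr flip: powr_add powr_numeral)
      ultimately have "y\<^sup>2 * (e * y powr (- r)) \<le> y\<^sup>2 * \<bar>\<eta> - x\<bar>"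
        using assms(1) by (simp add: e_def field_simps)
      then have "e * y powr (- r) \<le> \<bar>\<eta> - x\<bar>" using y1 by simp
      also have "\<dots> < y powr (- \<mu>)" using pq(4) by (simp add: y_def powr_minus_divide)
      finally have "e * y powr (- r) * y powr \<mu> < y powr (- \<mu>) * y powr \<mu>"
        using y1 by (intro mult_strict_right_mono) auto
      then have "e * y powr (\<mu> - r) < 1" using y1 by (simp add: mult.assoc flip: powr_add)
      then have "y powr (\<mu> - r) < 1 / e" using e by (simp add: field_simps)
      then have "(y powr (\<mu> - r)) powr (1 / (\<mu> - r)) \<le> Q"
        unfolding Q_def using assms by (intro powr_mono2) auto
      then have yQ: "y \<le> Q" using y1 assms by (simp add: powr_powr)
      have "\<bar>of_int p\<bar> = \<bar>x\<bar> * y" by (simp add: p y_def abs_mult)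
      also have "\<dots> \<le> (\<eta> + 1) * Q" using xa yQ y1 by (intro mult_mono) auto
      finally have "\<bar>p\<bar> \<le> int B" "\<bar>q\<bar> \<le> int B" using yQ unfolding B_def y_def by linarith+
      then show ?thesis using pq(2) by (auto intro!: image_eqI[of _ _ "(p, q)"])
    qed simp
  qed
  then show ?thesis by (rule finite_subset) auto
qed

text \<open>One inequality is an inclusion of index sets. The other shifts \<open>r\<close> by an
  arbitrary \<open>e > 0\<close>, which also makes the order positive when
  \<open>r = 0\<close>.\<close>

lemma irrationality_measure_eq:
  assumes "\<eta> > 0"
  shows "irrationality_measure \<eta> = Inf {ereal r |r. 0 \<le> r \<and> symbol_bound \<eta> r}"
proof -
  have eq: "irrationality_measure \<eta> = Inf {ereal \<mu> |\<mu>. 0 < \<mu> \<and> finite (approximants \<eta> \<mu>)}"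
    by (simp add: irrationality_measure_def approximants_def)
  show ?thesis
    unfolding eq
  proof (rule antisym)
    show "Inf {ereal r |r. 0 \<le> r \<and> symbol_bound \<eta> r} \<le> Inf {ereal \<mu> |\<mu>. 0 < \<mu> \<and> finite (approximants \<eta> \<mu>)}"
      using symbol_bound_of_finite[OF assms] by (intro Inf_superset_mono) force
    show "Inf {ereal \<mu> |\<mu>. 0 < \<mu> \<and> finite (approximants \<eta> \<mu>)} \<le> Inf {ereal r |r. 0 \<le> r \<and> symbol_bound \<eta> r}"
    proof (rule Inf_greatest, clarify)
      fix r assume r: "0 \<le> r" "symbol_bound \<eta> r"
      show "Inf {ereal \<mu> |\<mu>. 0 < \<mu> \<and> finite (approximants \<eta> \<mu>)} \<le> ereal r"
      proof (rule ereal_le_epsilon2)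
        fix e :: real assume "0 < e"
        have "finite (approximants \<eta> (r + e))"
          using finite_of_symbol_bound[OF assms r(1) _ r(2), of "r + e"] \<open>0 < e\<close> by simp
        then show "Inf {ereal \<mu> |\<mu>. 0 < \<mu> \<and> finite (approximants \<eta> \<mu>)} \<le> ereal r + ereal e"
          using r \<open>0 < e\<close> by (intro Inf_lower) auto
      qed
    qed
  qed
qed

section \<open>Zeros of the symbol and the rational case\<close>

lemma psym_eq_0_irrational:
  assumes "\<eta> \<notin> \<rat>" "psym \<eta> \<xi> = 0"
  shows "\<xi> = 0"
proof (rule ccontr)
  assume "\<xi> \<noteq> 0"
  have eq: "(of_int (fst \<xi>))\<^sup>2 = (\<eta> * of_int (snd \<xi>))\<^sup>2"
    using assms(2) by (simp add: psym_def power_mult_distrib)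
  have "snd \<xi> \<noteq> 0"
  proof
    assume "snd \<xi> = 0"
    with eq \<open>\<xi> \<noteq> 0\<close> show False by (simp add: prod_eq_iff)
  qed
  then have "\<eta> = of_int (fst \<xi>) / of_int (snd \<xi>) \<or> \<eta> = - of_int (fst \<xi>) / of_int (snd \<xi>)"
    using eq unfolding power2_eq_iff by (auto simp: field_simps)
  then show False using assms(1) by auto
qed

lemma Rats_pos_cases:
  fixes \<eta> :: real
  assumes "\<eta> \<in> \<rat>" "\<eta> > 0"
  obtains a b :: int where "0 < a" "0 < b" "\<eta> = of_int a / of_int b"
proof -
  obtain a b :: int where ab: "b > 0" "\<eta> = of_int a / of_int b"
    using assms(1) by (elim Rats_cases') auto
  then have "real_of_int a = \<eta> * of_int b" by simp
  then have "0 < real_of_int a" using ab(1) assms(2) by simp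
  then have "0 < a" by simp
  then show thesis using ab that by blast
qed

lemma infinite_psym_zeros:
  assumes "\<eta> \<in> \<rat>" "\<eta> > 0"
  shows "infinite {\<xi>. psym \<eta> \<xi> = 0}"
proof -
  obtain a b :: int where ab: "0 < a" "0 < b" "\<eta> = of_int a / of_int b"
    using Rats_pos_cases[OF assms] .
  have "range (\<lambda>n. (of_nat n * a, of_nat n * b)) \<subseteq> {\<xi>. psym \<eta> \<xi> = 0}"
  proof clarify
    fix n :: nat
    have "real_of_int a = \<eta> * of_int b" using ab by simp
    then show "psym \<eta> (int n * a, int n * b) = 0" by (simp add: psym_def algebra_simps power2_eq_square)
  qed
  moreover have "inj (\<lambda>n :: nat. (of_nat n * a, of_nat n * b))"
    using ab by (auto simp: inj_on_def)
  ultimately show ?thesis by (metis finite_subset range_inj_infinite)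
qed

text \<open>For \<open>\<eta> = a / b\<close> both factors of the symbol become integers after
  multiplication by \<open>b\<close>. Where nonzero, the small one is at least \<open>1 / b\<close>
  in modulus, and the large one grows like the bracket.\<close>

lemma symbol_bound_rational:
  assumes "\<eta> \<in> \<rat>" "\<eta> > 0"
  shows "symbol_bound \<eta> 1"
proof -
  obtain a b :: int where ab: "0 < a" "0 < b" "\<eta> = of_int a / of_int b"
    using Rats_pos_cases[OF assms] .
  \<comment> \<open>The three summands bound 1, \<open>x\<close> and \<open>y\<close> in turn by
    multiples of \<open>\<eta> * y + x\<close>.\<close>
  define M where "M = of_int b + 1 + 1 / \<eta>"
  have M: "0 < M" using ab by (simp add: M_def add_pos_pos)
  have "1 / (of_int b * M) * jb \<xi> powr (1 - 1 / 2) \<le> \<bar>psym \<eta> \<xi>\<bar>" if nz: "psym \<eta> \<xi> \<noteq> 0" for \<xi>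
  proof -
    define x where "x = \<bar>fst \<xi>\<bar>"
    define y where "y = \<bar>snd \<xi>\<bar>"
    have jb: "jb \<xi> = 1 + ((of_int x)\<^sup>2 + (of_int y)\<^sup>2)" by (simp add: jb_def x_def y_def)
    have p: "psym \<eta> \<xi> = (\<eta> * of_int y - of_int x) * (\<eta> * of_int y + of_int x)"
      unfolding psym_factor x_def y_def by simp
    have xy: "0 \<le> x" "0 \<le> y" by (simp_all add: x_def y_def)
    let ?s = "\<eta> * of_int y + of_int x"
    have b1: "of_int b * (\<eta> * of_int y - of_int x) = of_int (a * y - b * x)"
      "of_int b * ?s = of_int (a * y + b * x)"
      using ab by (simp_all add: field_simps)
    have "a * y - b * x \<noteq> 0" "a * y + b * x \<noteq> 0"
      using nz p b1 ab by (metis mult_zero_left mult_zero_right of_int_0 mult_eq_0_iff of_int_0_eq_iff less_irrefl)+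
    moreover have "0 \<le> a * y" "0 \<le> b * x" using ab xy by simp_all
    ultimately have "1 \<le> \<bar>a * y - b * x\<bar>" "1 \<le> a * y + b * x" by linarith+
    then have "1 \<le> \<bar>real_of_int (a * y - b * x)\<bar>" "1 \<le> real_of_int (a * y + b * x)" by linarith+
    then have bb: "1 \<le> of_int b * \<bar>\<eta> * of_int y - of_int x\<bar>" "1 \<le> of_int b * ?s"
      using ab unfolding b1[symmetric] by (simp_all add: abs_mult)
    have s0: "0 \<le> ?s" using xy assms by simp
    have "jb \<xi> powr (1 - 1 / 2) = sqrt (jb \<xi>)" using jb_pos[of \<xi>] by (simp add: powr_half_sqrt)
    also have "\<dots> \<le> 1 + of_int x + of_int y"
      using xy by (intro real_le_lsqrt) (auto simp: jb power2_eq_square algebra_simps)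
    also have "\<dots> \<le> of_int b * ?s + ?s + 1 / \<eta> * ?s"
      using bb xy assms by (intro add_mono) (auto simp: field_simps)
    also have "\<dots> = M * ?s" by (simp add: M_def algebra_simps)
    also have "\<dots> \<le> M * (of_int b * \<bar>\<eta> * of_int y - of_int x\<bar> * ?s)"
      using mult_right_mono[OF bb(1) s0] M by (intro mult_left_mono) auto
    also have "\<dots> = of_int b * M * \<bar>psym \<eta> \<xi>\<bar>" using s0 by (simp add: p abs_mult)
    finally show ?thesis using M ab(1,2) by (simp add: field_simps)
  qed
  moreover have "0 < 1 / (of_int b * M)" using M ab by simp
  ultimately show ?thesis unfolding symbol_bound_def by blast
qed

section \<open>Quadratic irrationals\<close>

lemma algebraic_degree_le:
  assumes "\<And>i. coeff p i \<in> \<int>" "p \<noteq> 0" "poly p x = 0"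
  shows "algebraic_degree x \<le> degree p"
  unfolding algebraic_degree_def by (rule Least_le) (use assms in blast)

lemma algebraic_degree_witness:
  assumes "algebraic x"
  obtains p where "\<And>i. coeff p i \<in> \<int>" "p \<noteq> 0" "poly p x = 0" "degree p = algebraic_degree x"
proof -
  have "\<exists>d p. (\<forall>i. coeff p i \<in> \<int>) \<and> p \<noteq> 0 \<and> poly p x = 0 \<and> degree p = d"
    using assms unfolding algebraic_def by blast
  then have "\<exists>p. (\<forall>i. coeff p i \<in> \<int>) \<and> p \<noteq> 0 \<and> poly p x = 0 \<and> degree p = algebraic_degree x"
    unfolding algebraic_degree_def by (rule LeastI_ex)
  then show thesis using that by blast
qed

lemma algebraic_degree_rational:
  assumes "x \<in> \<rat>"
  shows "algebraic_degree x \<le> 1"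
proof -
  obtain a b :: int where ab: "b > 0" "x = of_int a / of_int b"
    using assms by (elim Rats_cases') auto
  let ?p = "[:- of_int a, of_int b:] :: real poly"
  have "coeff ?p i \<in> \<int>" for i by (simp add: coeff_pCons split: nat.split)
  then have "algebraic_degree x \<le> degree ?p" using ab by (intro algebraic_degree_le) auto
  also have "\<dots> \<le> 1" by simp
  finally show ?thesis .
qed

text \<open>Liouville's argument: with \<open>\<theta>\<close> the conjugate of \<open>\<eta>\<close> and \<open>A\<close> the leading coefficient, the norm form
  \<open>A (x - \<eta> y) (x - \<theta> y)\<close> takes nonzero integer values.\<close>

lemma symbol_bound_quadratic:
  assumes pos: "\<eta> > 0" and alg: "algebraic \<eta>" "algebraic_degree \<eta> = 2"
  shows "\<eta> \<notin> \<rat>" "symbol_bound \<eta> 2"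
proof -
  show irr: "\<eta> \<notin> \<rat>" using algebraic_degree_rational[of \<eta>] alg by auto
  obtain p where p: "\<And>i. coeff p i \<in> \<int>" "p \<noteq> 0" "poly p \<eta> = 0" "degree p = 2"
    using algebraic_degree_witness[OF alg(1)] alg(2) by metis
  obtain A B C :: int where ABC: "coeff p 2 = of_int A" "coeff p 1 = of_int B" "coeff p 0 = of_int C"
    using p(1) by (metis Ints_cases)
  have A: "A \<noteq> 0" using p(2,4) ABC(1) by (metis leading_coeff_0_iff of_int_0)
  have "poly p \<eta> = of_int A * \<eta>\<^sup>2 + of_int B * \<eta> + of_int C"
    unfolding poly_altdef p(4) using ABC by (simp add: numeral_2_eq_2 algebra_simps)
  then have root: "of_int C = - (of_int A * \<eta>\<^sup>2) - of_int B * \<eta>" using p(3) by linarith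
  \<comment> \<open>The other root, since the two roots add up to \<open>- B / A\<close>.\<close>
  define \<theta> where "\<theta> = - of_int B / of_int A - \<eta>"
  have B: "of_int B = - of_int A * (\<eta> + \<theta>)" using A by (simp add: \<theta>_def field_simps)
  have norm: "of_int (A * x\<^sup>2 + B * x * y + C * y\<^sup>2) = of_int A * (of_int x - \<eta> * of_int y) * (of_int x - \<theta> * of_int y)"
    for x y
    unfolding of_int_add of_int_mult of_int_power root B by (simp add: algebra_simps power2_eq_square)
  have irr': "\<theta> \<notin> \<rat>"
  proof
    assume "\<theta> \<in> \<rat>"
    then have "- of_int B / of_int A - \<theta> \<in> \<rat>" by auto
    then show False using irr by (simp add: \<theta>_def)
  qed
  have nonzero: "of_int x - t * of_int y \<noteq> 0" if "t \<notin> \<rat>" "(x, y) \<noteq> (0, 0)" for x y :: int and t :: real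
  proof
    assume eq: "of_int x - t * of_int y = 0"
    have "y \<noteq> 0" using eq that(2) by auto
    then have "t = of_int x / of_int y" using eq by (simp add: field_simps)
    then show False using that(1) by auto
  qed
  \<comment> \<open>Chosen so that the conjugate factor \<open>x - \<theta> * y\<close> is at most
    \<open>M\<close> times the factor \<open>\<eta> * y + x\<close> of the symbol.\<close>
  define M where "M = 1 + \<bar>\<theta>\<bar> / \<eta>"
  have M: "0 < M" using pos by (simp add: M_def add_pos_nonneg)
  have "1 / (\<bar>of_int A\<bar> * M) * jb \<xi> powr (1 - 2 / 2) \<le> \<bar>psym \<eta> \<xi>\<bar>" if nz: "psym \<eta> \<xi> \<noteq> 0" for \<xi>
  proof -
    define x where "x = \<bar>fst \<xi>\<bar>"
    define y where "y = \<bar>snd \<xi>\<bar>"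
    have ps: "psym \<eta> \<xi> = (\<eta> * of_int y - of_int x) * (\<eta> * of_int y + of_int x)"
      unfolding psym_factor x_def y_def by simp
    have xy: "0 \<le> x" "0 \<le> y" by (simp_all add: x_def y_def)
    have "(x, y) \<noteq> (0, 0)" using nz ps by auto
    then have "real_of_int (A * x\<^sup>2 + B * x * y + C * y\<^sup>2) \<noteq> 0"
      unfolding norm using nonzero irr irr' A by simp
    then have "1 \<le> \<bar>A * x\<^sup>2 + B * x * y + C * y\<^sup>2\<bar>" by linarith
    then have "1 \<le> \<bar>real_of_int (A * x\<^sup>2 + B * x * y + C * y\<^sup>2)\<bar>" by linarith
    also have "\<dots> = \<bar>of_int A\<bar> * \<bar>of_int x - \<eta> * of_int y\<bar> * \<bar>of_int x - \<theta> * of_int y\<bar>"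
      unfolding norm by (simp add: abs_mult)
    also have "\<dots> \<le> \<bar>of_int A\<bar> * \<bar>of_int x - \<eta> * of_int y\<bar> * (M * (\<eta> * of_int y + of_int x))"
    proof (intro mult_left_mono)
      have "\<bar>of_int x - \<theta> * of_int y\<bar> \<le> of_int x + \<bar>\<theta>\<bar> * of_int y"
        using xy abs_triangle_ineq4[of "of_int x" "\<theta> * of_int y"] by (simp add: abs_mult)
      also have "\<dots> \<le> of_int x + \<bar>\<theta>\<bar> * of_int y + (\<eta> * of_int y + \<bar>\<theta>\<bar> / \<eta> * of_int x)"
        using xy pos by simp
      also have "\<dots> = M * (\<eta> * of_int y + of_int x)" using pos by (simp add: M_def field_simps)
      finally show "\<bar>of_int x - \<theta> * of_int y\<bar> \<le> M * (\<eta> * of_int y + of_int x)" .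
    qed simp
    also have "\<dots> = \<bar>of_int A\<bar> * M * \<bar>psym \<eta> \<xi>\<bar>"
      using xy pos by (simp add: ps abs_mult abs_minus_commute)
    finally show ?thesis using M A jb_pos[of \<xi>] by (simp add: field_simps)
  qed
  moreover have "0 < 1 / (\<bar>of_int A\<bar> * M)" using M A by simp
  ultimately show "symbol_bound \<eta> 2" unfolding symbol_bound_def by blast
qed

section \<open>Hypoellipticity and solvability\<close>

lemma wave_symbol_eq: "wave_symbol \<eta> \<xi> = of_real (psym \<eta> \<xi>)"
  by (simp add: wave_symbol_def psym_def)

lemma fourier_coeff_wave_op:
  "u \<in> distributions \<Longrightarrow> fourier_coeff (wave_op \<eta> u) \<xi> = of_real (psym \<eta> \<xi>) * fourier_coeff u \<xi>"
  using fourier_multiplier_wave_op[of \<eta>] unfolding fourier_multiplier_def wave_symbol_eq by blast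

lemma sobolev_iff:
  "u \<in> sobolev k \<longleftrightarrow> u \<in> distributions \<and>
    (\<lambda>\<xi>. jb \<xi> powr k * (cmod (fourier_coeff u \<xi>))\<^sup>2) summable_on UNIV"
  by (simp add: sobolev_def jb_def)

text \<open>Each term is at most the total sum. The inequality \<open>t \<le> 1 + t^2\<close> avoids
  square roots, and \<open>n \<ge> \<bar>k\<bar>\<close> covers both signs of
  \<open>k\<close>.\<close>

lemma polybdd_of_summable:
  assumes "(\<lambda>\<xi>. jb \<xi> powr k * (cmod (c \<xi>))\<^sup>2) summable_on UNIV"
  shows "polybdd c"
proof -
  let ?g = "\<lambda>\<xi>. jb \<xi> powr k * (cmod (c \<xi>))\<^sup>2"
  define S where "S = infsum ?g UNIV"
  have le: "?g \<xi> \<le> S" for \<xi>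
    using finite_sum_le_infsum[OF assms, of "{\<xi>}"] by (simp add: S_def)
  define n where "n = nat \<lceil>\<bar>k\<bar>\<rceil>"
  have "cmod (c \<xi>) \<le> (1 + \<bar>S\<bar>) * jb \<xi> ^ n" for \<xi>
  proof -
    have j: "0 < jb \<xi>" "1 \<le> jb \<xi>" by (rule jb_pos jb_ge_1)+
    have "(cmod (c \<xi>))\<^sup>2 = jb \<xi> powr (- k) * ?g \<xi>"
      using j by (simp add: mult.assoc[symmetric] powr_minus)
    also have "\<dots> \<le> jb \<xi> powr (- k) * \<bar>S\<bar>"
      using le[of \<xi>] by (intro mult_left_mono) auto
    also have "\<dots> \<le> jb \<xi> powr (real n) * \<bar>S\<bar>"
      using j by (intro mult_right_mono powr_mono) (auto simp: n_def, linarith)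
    also have "\<dots> = \<bar>S\<bar> * jb \<xi> ^ n" using j by (simp add: powr_realpow)
    finally have "(cmod (c \<xi>))\<^sup>2 \<le> \<bar>S\<bar> * jb \<xi> ^ n" .
    moreover have "1 \<le> jb \<xi> ^ n" using j by simp
    moreover have "2 * cmod (c \<xi>) \<le> 1 + (cmod (c \<xi>))\<^sup>2"
      using zero_le_power2[of "cmod (c \<xi>) - 1"] unfolding power2_diff by simp
    then have "cmod (c \<xi>) \<le> 1 + (cmod (c \<xi>))\<^sup>2"
      using norm_ge_zero[of "c \<xi>"] by linarith
    ultimately show ?thesis by (simp add: distrib_right)
  qed
  then show ?thesis unfolding polybdd_def by blast
qed

lemma synth_sobolev:
  assumes "(\<lambda>\<xi>. jb \<xi> powr k * (cmod (c \<xi>))\<^sup>2) summable_on UNIV"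
  shows "synth c \<in> sobolev k"
  using assms synth_distribution[OF polybdd_of_summable[OF assms]]
  by (simp add: sobolev_iff fourier_coeff_synth)

lemma symbol_bound_weight:
  assumes c: "c > 0" "c * jb \<xi> powr (1 - r / 2) \<le> \<bar>psym \<eta> \<xi>\<bar>"
  shows "jb \<xi> powr (k + 2 - r) * w\<^sup>2 \<le> 1 / c\<^sup>2 * (jb \<xi> powr k * (psym \<eta> \<xi> * w)\<^sup>2)"
proof -
  have "(c * jb \<xi> powr (1 - r / 2))\<^sup>2 \<le> \<bar>psym \<eta> \<xi>\<bar>\<^sup>2"
    using c by (intro power_mono) auto
  also have "(c * jb \<xi> powr (1 - r / 2))\<^sup>2 = c\<^sup>2 * jb \<xi> powr (2 - r)"
    by (simp add: power_mult_distrib power2_eq_square flip: powr_add)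
  finally have "jb \<xi> powr k * (c\<^sup>2 * jb \<xi> powr (2 - r)) * w\<^sup>2 \<le> jb \<xi> powr k * (psym \<eta> \<xi>)\<^sup>2 * w\<^sup>2"
    by (intro mult_right_mono mult_left_mono) auto
  moreover have "jb \<xi> powr (k + 2 - r) = jb \<xi> powr k * jb \<xi> powr (2 - r)"
    by (simp add: algebra_simps flip: powr_add)
  ultimately show ?thesis using c(1) by (simp add: field_simps power_mult_distrib)
qed

section \<open>The symbol bound is sufficient\<close>

lemma GH_if_symbol_bound:
  assumes bound: "symbol_bound \<eta> r" and fin: "finite {\<xi>. psym \<eta> \<xi> = 0}"
  shows "GH 2 (wave_op \<eta>) r"
  unfolding GH_def
proof (intro allI ballI impI)
  fix k u assume u: "u \<in> distributions" and Pu: "wave_op \<eta> u \<in> sobolev k"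
  obtain c where c: "0 < c" "\<And>\<xi>. psym \<eta> \<xi> \<noteq> 0 \<Longrightarrow> c * jb \<xi> powr (1 - r / 2) \<le> \<bar>psym \<eta> \<xi>\<bar>"
    using bound by (auto simp: symbol_bound_def)
  let ?f = "\<lambda>\<xi>. jb \<xi> powr (k + 2 - r) * (cmod (fourier_coeff u \<xi>))\<^sup>2"
  let ?Z = "{\<xi>. psym \<eta> \<xi> = 0}"
  have "(\<lambda>\<xi>. jb \<xi> powr k * (psym \<eta> \<xi> * cmod (fourier_coeff u \<xi>))\<^sup>2) summable_on UNIV"
    using Pu by (simp add: sobolev_iff fourier_coeff_wave_op[OF u] norm_mult power_mult_distrib)
  then have "(\<lambda>\<xi>. 1 / c\<^sup>2 * (jb \<xi> powr k * (psym \<eta> \<xi> * cmod (fourier_coeff u \<xi>))\<^sup>2)) summable_on (- ?Z)"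
    by (intro summable_on_cmult_right) (rule summable_on_subset_banach, auto)
  then have "?f summable_on (- ?Z)"
    by (rule summable_on_comparison_test) (rule symbol_bound_weight[OF c(1) c(2)], simp_all)
  \<comment> \<open>At zeros of the symbol the equation says nothing about \<open>u\<close>;
    finiteness makes them harmless.\<close>
  moreover have "?f summable_on ?Z" using fin by simp
  ultimately have "?f summable_on (- ?Z \<union> ?Z)" by (intro summable_on_Un_disjoint) auto
  then show "u \<in> sobolev (k + 2 - r)" using u by (simp add: sobolev_iff)
qed

lemma dist_of_eq: "f \<in> smooth_T2 \<Longrightarrow> dist_of g f = integral cell (\<lambda>z. g z * f z)"
  by (simp add: dist_of_def)

lemma wave_op_eval:
  "f \<in> smooth_T2 \<Longrightarrow> wave_op \<eta> u f = u (pderiv1 (pderiv1 f)) - of_real (\<eta>\<^sup>2) * u (pderiv2 (pderiv2 f))"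
  using smooth_pderiv1 smooth_pderiv2 by (simp add: wave_op_def dist_pderiv1_def dist_pderiv2_def)

text \<open>These kernel elements force a datum in the annihilator to have vanishing coefficients at
  the zeros of the symbol.\<close>

lemma character_in_kernel:
  assumes "psym \<eta> \<xi> = 0"
  shows "character \<xi> \<in> smooth_ker_transpose (wave_op \<eta>)"
proof -
  have "wave_op \<eta> (dist_of f) (character \<xi>) = 0" for f
  proof -
    have d: "pderiv1 (character \<xi>) = (\<lambda>z. (\<i> * of_int (fst \<xi>)) * character \<xi> z)"
      "pderiv2 (character \<xi>) = (\<lambda>z. (\<i> * of_int (snd \<xi>)) * character \<xi> z)"
      using pderiv1_character[of 1 \<xi>] pderiv2_character[of 1 \<xi>] by simp_all
    have "dist_of f (\<lambda>z. a * character \<xi> z) = a * dist_of f (character \<xi>)" for a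
      by (simp add: dist_of_eq smooth_character smooth_char mult.left_commute[of _ a])
    then have "wave_op \<eta> (dist_of f) (character \<xi>) = of_real (psym \<eta> \<xi>) * dist_of f (character \<xi>)"
      by (simp only: wave_op_eval[OF smooth_char] d pderiv1_character pderiv2_character)
        (simp add: psym_def power2_eq_square algebra_simps)
    then show ?thesis using assms by simp
  qed
  then show ?thesis
    by (auto simp: smooth_ker_transpose_def smooth_char transpose_op_def)
qed

text \<open>Converse information, from testing the transpose on characters: it shows that the
  counterexample datum lies in the annihilator.\<close>

lemma fint_kernel:
  assumes "f \<in> smooth_ker_transpose (wave_op \<eta>)"
  shows "psym \<eta> \<xi> * fint f \<xi> = 0"
proof -
  have f: "f \<in> smooth_T2" and "transpose_op (wave_op \<eta>) f (character \<xi>) = 0"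
    using assms by (simp_all add: smooth_ker_transpose_def)
  then have "wave_op \<eta> (dist_of (character \<xi>)) f = 0"
    by (simp add: transpose_op_def smooth_char)
  moreover have "dist_of (character \<xi>) g = fint g \<xi>" if "g \<in> smooth_T2" for g
    using that by (simp add: dist_of_eq fint_def mult.commute)
  ultimately show ?thesis
    using f smooth_pderiv1[OF f] smooth_pderiv2[OF f]
    by (simp add: wave_op_eval smooth_pderiv1 smooth_pderiv2 fint_pderiv psym_def algebra_simps power2_eq_square)
qed

text \<open>The coefficients \<open>a\<close> of the solution are \<open>0\<close> at the zeros of the symbol because \<open>x / 0 = 0\<close>.\<close>

lemma GS_if_symbol_bound:
  assumes bound: "symbol_bound \<eta> r"
  shows "GS 2 (wave_op \<eta>) r"
  unfolding GS_def
proof (intro allI ballI)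
  fix k f assume "f \<in> sobolev k \<inter> annihilator (smooth_ker_transpose (wave_op \<eta>))"
  then have f: "f \<in> distributions" "(\<lambda>\<xi>. jb \<xi> powr k * (cmod (fourier_coeff f \<xi>))\<^sup>2) summable_on UNIV"
    and ann: "\<And>g. g \<in> smooth_ker_transpose (wave_op \<eta>) \<Longrightarrow> f g = 0"
    by (auto simp: sobolev_iff annihilator_def)
  obtain c where c: "0 < c" "\<And>\<xi>. psym \<eta> \<xi> \<noteq> 0 \<Longrightarrow> c * jb \<xi> powr (1 - r / 2) \<le> \<bar>psym \<eta> \<xi>\<bar>"
    using bound by (auto simp: symbol_bound_def)
  \<comment> \<open>The coefficient at \<open>\<xi>\<close> pairs with
    \<open>character (- \<xi>)\<close>; the symbol is even.\<close>
  have zero: "fourier_coeff f \<xi> = 0" if "psym \<eta> \<xi> = 0" for \<xi>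
    using ann[OF character_in_kernel[of \<eta> "- \<xi>"]] that by (simp add: fourier_coeff_def psym_def)
  define a where "a \<xi> = fourier_coeff f \<xi> / of_real (psym \<eta> \<xi>)" for \<xi>
  have a: "of_real (psym \<eta> \<xi>) * a \<xi> = fourier_coeff f \<xi>" for \<xi>
    using zero by (cases "psym \<eta> \<xi> = 0") (auto simp: a_def)
  have "(\<lambda>\<xi>. 1 / c\<^sup>2 * (jb \<xi> powr k * (cmod (fourier_coeff f \<xi>))\<^sup>2)) summable_on UNIV"
    by (intro summable_on_cmult_right f)
  then have "(\<lambda>\<xi>. jb \<xi> powr (k + 2 - r) * (cmod (a \<xi>))\<^sup>2) summable_on UNIV"
  proof (rule summable_on_comparison_test)
    fix \<xi>
    show "jb \<xi> powr (k + 2 - r) * (cmod (a \<xi>))\<^sup>2 \<le> 1 / c\<^sup>2 * (jb \<xi> powr k * (cmod (fourier_coeff f \<xi>))\<^sup>2)"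
    proof (cases "psym \<eta> \<xi> = 0")
      case False
      have "(cmod (fourier_coeff f \<xi>))\<^sup>2 = (psym \<eta> \<xi> * cmod (a \<xi>))\<^sup>2"
        unfolding a[symmetric] by (simp add: norm_mult power_mult_distrib)
      then show ?thesis using symbol_bound_weight[OF c(1) c(2)[OF False]] by metis
    qed (simp add: a_def)
  qed simp
  note sum = this
  show "\<exists>u\<in>sobolev (k + 2 - r). wave_op \<eta> u = f"
  proof
    show "synth a \<in> sobolev (k + 2 - r)" by (rule synth_sobolev[OF sum])
    have "wave_op \<eta> (synth a) = synth (\<lambda>\<xi>. of_real (psym \<eta> \<xi>) * a \<xi>)"
      by (simp add: wave_op_synth[OF polybdd_of_summable[OF sum]] wave_symbol_eq)
    then show "wave_op \<eta> (synth a) = f" by (simp add: a distribution_eq_synth[OF f(1), symmetric])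
  qed
qed

section \<open>The symbol bound is necessary\<close>

lemma indicator_not_sobolev:
  assumes "infinite S" "\<And>\<xi>. \<xi> \<in> S \<Longrightarrow> fourier_coeff u \<xi> = 1"
  shows "u \<notin> sobolev 0"
proof
  assume "u \<in> sobolev 0"
  then have "(\<lambda>\<xi>. jb \<xi> powr 0 * (cmod (fourier_coeff u \<xi>))\<^sup>2) summable_on S"
    unfolding sobolev_iff by (blast intro: summable_on_subset_banach)
  then have "(\<lambda>\<xi>. 1 :: real) summable_on S"
    using assms(2) jb_pos by (subst summable_on_cong[of S _ "\<lambda>\<xi>. jb \<xi> powr 0 * (cmod (fourier_coeff u \<xi>))\<^sup>2"])
      (auto simp: less_imp_neq[THEN not_sym])
  then show False using infsum_diverge_constant[OF assms(1), of "1 :: real"] by simp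
qed

text \<open>The order \<open>r - 2\<close> is the one for which a loss of \<open>r\<close> would put
  the solution in \<open>H^0\<close>, where infinitely many coefficients equal to 1 are
  impossible.\<close>

lemma loss_counterexample:
  assumes sum: "(\<lambda>\<xi>. jb \<xi> powr (r - 2) * (psym \<eta> \<xi>)\<^sup>2) summable_on S"
  defines "c \<equiv> \<lambda>\<xi>. if \<xi> \<in> S then 1 else 0 :: complex"
  shows "polybdd c" "wave_op \<eta> (synth c) \<in> sobolev (r - 2)"
proof -
  show pc: "polybdd c"
    unfolding polybdd_def c_def by (intro exI[of _ 1] exI[of _ 0]) auto
  have "(\<lambda>\<xi>. jb \<xi> powr (r - 2) * (cmod (wave_symbol \<eta> \<xi> * c \<xi>))\<^sup>2) summable_on UNIV"
    by (rule summable_on_cong_neutral[THEN iffD1, OF _ _ _ sum]) (auto simp: c_def wave_symbol_eq)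
  then show "wave_op \<eta> (synth c) \<in> sobolev (r - 2)"
    unfolding wave_op_synth[OF pc] by (rule synth_sobolev)
qed

text \<open>\<open>S\<close> may contain zeros of the symbol; for rational \<open>\<eta>\<close> it
  will be the whole zero set, where the summand vanishes.\<close>

lemma not_GH:
  assumes "infinite S" "(\<lambda>\<xi>. jb \<xi> powr (r - 2) * (psym \<eta> \<xi>)\<^sup>2) summable_on S"
  shows "\<not> GH 2 (wave_op \<eta>) r"
proof
  let ?c = "\<lambda>\<xi>. if \<xi> \<in> S then 1 else 0 :: complex"
  assume "GH 2 (wave_op \<eta>) r"
  then have "synth ?c \<in> sobolev (r - 2 + 2 - r)"
    using loss_counterexample[OF assms(2)] synth_distribution unfolding GH_def by blast
  then show False
    using indicator_not_sobolev[OF assms(1), of "synth ?c"] by (simp add: fourier_coeff_synth)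
qed

text \<open>A solution is not unique, but off the zeros its coefficients are determined, so every
  solution has coefficient 1 on \<open>S\<close>.\<close>

lemma not_GS:
  assumes "infinite S" "(\<lambda>\<xi>. jb \<xi> powr (r - 2) * (psym \<eta> \<xi>)\<^sup>2) summable_on S"
    and nz: "\<And>\<xi>. \<xi> \<in> S \<Longrightarrow> psym \<eta> \<xi> \<noteq> 0"
  shows "\<not> GS 2 (wave_op \<eta>) r"
proof
  let ?c = "\<lambda>\<xi>. if \<xi> \<in> S then 1 else 0 :: complex"
  let ?f = "wave_op \<eta> (synth ?c)"
  note cx = loss_counterexample[OF assms(2)]
  have "?f g = 0" if g: "g \<in> smooth_ker_transpose (wave_op \<eta>)" for g
  proof -
    have "wave_symbol \<eta> \<xi> * ?c \<xi> * fint g \<xi> = 0" for \<xi>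
      using fint_kernel[OF g, of \<xi>] by (auto simp: wave_symbol_eq)
    then show ?thesis
      unfolding wave_op_synth[OF cx(1)] unfolding synth_def by (simp only: infsum_0_simp if_cancel)
  qed
  then have "?f \<in> sobolev (r - 2) \<inter> annihilator (smooth_ker_transpose (wave_op \<eta>))"
    using cx(2) by (auto simp: annihilator_def sobolev_iff)
  moreover assume "GS 2 (wave_op \<eta>) r"
  ultimately obtain u where u: "u \<in> sobolev (r - 2 + 2 - r)" "wave_op \<eta> u = ?f"
    unfolding GS_def by blast
  have ud: "u \<in> distributions" using u(1) by (simp add: sobolev_iff)
  have "fourier_coeff u \<xi> = 1" if "\<xi> \<in> S" for \<xi>
  proof -
    have "of_real (psym \<eta> \<xi>) * fourier_coeff u \<xi> = of_real (psym \<eta> \<xi>) * ?c \<xi>"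
      using fourier_coeff_wave_op[OF ud] fourier_coeff_wave_op[OF synth_distribution[OF cx(1)]] u(2)
      by (metis fourier_coeff_synth)
    then show ?thesis using nz[OF that] that by simp
  qed
  then show False using indicator_not_sobolev[OF assms(1)] u(1) by simp
qed

text \<open>Making the weights decrease strictly keeps the chosen frequencies distinct.\<close>

lemma small_symbol_set:
  assumes "\<not> symbol_bound \<eta> r"
  obtains S where "infinite S" "(\<lambda>\<xi>. jb \<xi> powr (r - 2) * (psym \<eta> \<xi>)\<^sup>2) summable_on S"
    "\<And>\<xi>. \<xi> \<in> S \<Longrightarrow> psym \<eta> \<xi> \<noteq> 0"
proof -
  define q where "q \<xi> = jb \<xi> powr (r - 2) * (psym \<eta> \<xi>)\<^sup>2" for \<xi>
  have small: "\<exists>\<xi>. psym \<eta> \<xi> \<noteq> 0 \<and> q \<xi> < e" if "0 < e" for e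
  proof -
    \<comment> \<open>The bound fails for the constant \<open>sqrt e\<close>; squaring turns it into
      \<open>e\<close> and the exponent into \<open>2 - r\<close>, which the weight in
      \<open>q\<close> cancels.\<close>
    obtain \<xi> where \<xi>: "psym \<eta> \<xi> \<noteq> 0" "\<bar>psym \<eta> \<xi>\<bar> < sqrt e * jb \<xi> powr (1 - r / 2)"
      using assms \<open>0 < e\<close> unfolding symbol_bound_def by (auto simp: not_le dest!: spec[of _ "sqrt e"])
    have "\<bar>psym \<eta> \<xi>\<bar>\<^sup>2 < (sqrt e * jb \<xi> powr (1 - r / 2))\<^sup>2"
      using \<xi>(2) by (intro power_strict_mono) auto
    also have "\<dots> = e * jb \<xi> powr (2 - r)"
      using \<open>0 < e\<close> by (simp add: power_mult_distrib power2_eq_square[of "_ powr _"] flip: powr_add)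
    finally have "jb \<xi> powr (r - 2) * (psym \<eta> \<xi>)\<^sup>2 < jb \<xi> powr (r - 2) * (e * jb \<xi> powr (2 - r))"
      using jb_pos[of \<xi>] by (intro mult_strict_left_mono) auto
    also have "\<dots> = e * (jb \<xi> powr (r - 2) * jb \<xi> powr (2 - r))" by simp
    also have "\<dots> = e" using jb_pos[of \<xi>] by (simp flip: powr_add)
    finally show ?thesis using \<xi>(1) unfolding q_def by blast
  qed
  have pos: "0 < q \<xi>" if "psym \<eta> \<xi> \<noteq> 0" for \<xi>
    using that jb_pos[of \<xi>] by (simp add: q_def)
  have "\<exists>s. \<forall>n. (psym \<eta> (s n) \<noteq> 0 \<and> q (s n) < (1 / 2) ^ n) \<and> q (s (Suc n)) < q (s n)"
  proof (rule dependent_nat_choice)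
    show "\<exists>\<xi>. psym \<eta> \<xi> \<noteq> 0 \<and> q \<xi> < (1 / 2) ^ 0" using small by simp
    fix \<xi> n assume "psym \<eta> \<xi> \<noteq> 0 \<and> q \<xi> < (1 / 2) ^ n"
    then show "\<exists>\<zeta>. (psym \<eta> \<zeta> \<noteq> 0 \<and> q \<zeta> < (1 / 2) ^ Suc n) \<and> q \<zeta> < q \<xi>"
      using small[of "min ((1 / 2) ^ Suc n) (q \<xi>)"] pos by (auto simp del: power_Suc)
  qed
  then obtain s where s: "\<And>n. psym \<eta> (s n) \<noteq> 0" "\<And>n. q (s n) < (1 / 2) ^ n" "\<And>n. q (s (Suc n)) < q (s n)"
    by blast
  have "q (s n) < q (s m)" if "m < n" for m n
    using lift_Suc_mono_less[of "\<lambda>n. - q (s n)" m n] s(3) that by simp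
  then have inj: "inj s" by (intro linorder_injI) (metis less_irrefl)
  have "(\<lambda>n. q (s n)) summable_on UNIV"
  proof (rule summable_nonneg_imp_summable_on)
    show "summable (\<lambda>n. q (s n))"
      by (rule summable_comparison_test'[OF summable_geometric[of "1 / 2 :: real"], of 0])
        (use s(2) pos[OF s(1)] in \<open>auto simp: less_imp_le\<close>)
  qed (use pos[OF s(1)] in \<open>simp add: less_imp_le\<close>)
  then have "q summable_on range s" using inj by (simp add: summable_on_reindex o_def)
  moreover have "infinite (range s)" using inj by (rule range_inj_infinite)
  ultimately show thesis using s(1) by (intro that[of "range s"]) (auto simp: q_def[abs_def])
qed

lemma GS_iff_symbol_bound: "GS 2 (wave_op \<eta>) r \<longleftrightarrow> symbol_bound \<eta> r"
  using GS_if_symbol_bound not_GS small_symbol_set by metis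

lemma GH_imp_symbol_bound: "GH 2 (wave_op \<eta>) r \<Longrightarrow> symbol_bound \<eta> r"
  using not_GH small_symbol_set by metis

theorem theorem5p1:
  fixes \<eta> :: real
  assumes "\<eta> > 0"
  shows "(\<eta> \<notin> \<rat> \<longrightarrow> ind_GH 2 (wave_op \<eta>) = irrationality_measure \<eta>) \<and>
    (\<eta> \<in> \<rat> \<longrightarrow> ind_GH 2 (wave_op \<eta>) = \<infinity>) \<and>
    (ind_GS 2 (wave_op \<eta>) = irrationality_measure \<eta> \<and> (\<eta> \<in> \<rat> \<longrightarrow> GS 2 (wave_op \<eta>) 1)) \<and>
    (algebraic \<eta> \<and> algebraic_degree \<eta> = 2 \<longrightarrow> GH 2 (wave_op \<eta>) 2 \<and> GS 2 (wave_op \<eta>) 2)"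
proof -
  have GH_irrational: "GH 2 (wave_op \<eta>) r \<longleftrightarrow> symbol_bound \<eta> r" if "\<eta> \<notin> \<rat>" for r
  proof -
    have "{\<xi>. psym \<eta> \<xi> = 0} \<subseteq> {0}" using psym_eq_0_irrational[OF that] by auto
    then have "finite {\<xi>. psym \<eta> \<xi> = 0}" by (rule finite_subset) simp
    then show ?thesis using GH_if_symbol_bound GH_imp_symbol_bound by blast
  qed
  have "\<not> GH 2 (wave_op \<eta>) r" if "\<eta> \<in> \<rat>" for r
    by (rule not_GH[OF infinite_psym_zeros[OF that assms]])
      (rule summable_on_0, simp)
  then have "ind_GH 2 (wave_op \<eta>) = \<infinity>" if "\<eta> \<in> \<rat>"
    \<comment> \<open>The index set is empty, and the infimum of the empty set in
      \<open>ereal\<close> is the top element.\<close>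
    using that by (simp add: ind_GH_def top_ereal_def)
  moreover have "ind_GH 2 (wave_op \<eta>) = irrationality_measure \<eta>" if "\<eta> \<notin> \<rat>"
    by (simp add: ind_GH_def irrationality_measure_eq[OF assms] GH_irrational[OF that])
  moreover have "ind_GS 2 (wave_op \<eta>) = irrationality_measure \<eta>"
    by (simp add: ind_GS_def irrationality_measure_eq[OF assms] GS_iff_symbol_bound)
  moreover have "GS 2 (wave_op \<eta>) 1" if "\<eta> \<in> \<rat>"
    using symbol_bound_rational[OF that assms] by (simp add: GS_iff_symbol_bound)
  moreover have "GH 2 (wave_op \<eta>) 2 \<and> GS 2 (wave_op \<eta>) 2" if "algebraic \<eta>" "algebraic_degree \<eta> = 2"
    using symbol_bound_quadratic[OF assms that] GH_irrational by (simp add: GS_iff_symbol_bound)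
  ultimately show ?thesis by blast
qed

end
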